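(* Let $\sigma$ be a finite product (composition) of the Arnoux-Rauzy substitutions $\sigma_1,\sigma_2,\sigma_3$ in which each of the three substitutions appears at least once. The Rauzy fractal associated with $\sigma$ is connected, and $\mathbf 0$ is an inner point of it (i.e., belongs to its interior as a subset of the contracting plane $\mathcal P_{\mathrm c}$).
   Context: Let $\mathcal A=\{1,2,3\}$. A substitution is a morphism of the free monoid $\mathcal A^*$ such that the image of each letter is non-empty. The Arnoux-Rauzy substitutions are given, for $i\in\{1,2,3\}$, by $\sigma_i(i)=i$ and $\sigma_i(j)=ji$ for $j\neq i$. The incidence matrix $\mathbf M_\sigma=(m_{ij})$ of a substitution $\sigma$ has $m_{ij}=$ number of occurrences of the letter $i$ in $\sigma(j)$; $\sigma$ is unimodular if $\det \mathbf M_\sigma=\pm1$. Let $(\mathbf e_1,\mathbf e_2,\mathbf e_3)$ be the canonical basis of $\mathbb R^3$. For $\mathbf x\in\mathbb Z^3$ and $i\in\{1,2,3\}$, the unit face $[\mathbf x,i]^*$ is $\{\mathbf x+\lambda\mathbf e_j+\mu\mathbf e_k:\lambda,\mu\in[0,1]\}$ with $\{i,j,k\}=\{1,2,3\}$. Put $\mathcal U=[\mathbf 0,1]^*\cup[\mathbf 0,2]^*\cup[\mathbf 0,3]^*$. For a unimodular substitution $\sigma$, the dual substitution $\mathbf E_1^*(\sigma)$ is $$\mathbf E_1^*(\sigma)([\mathbf x,i]^* )=\mathbf M_\sigma^{-1}\mathbf x+\bigcup_{j=1,2,3}\ \bigcup_{s\in\mathcal A^*:\ \sigma(j)=pis}[\mathbf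 M_\sigma^{-1}\ell(s),j]^*,$$ where the second union is over all suffixes $s$ of $\sigma(j)$ such that $\sigma(j)=pis$ for some $p\in\mathcal A^*$, and $\ell(s)=(|s|_1,|s|_2,|s|_3)$ counts the letters of $s$; it is extended to unions of unit faces by taking unions of images. A product $\sigma$ of $\sigma_1,\sigma_2,\sigma_3$ in which each appears at least once is unimodular and Pisot irreducible: the characteristic polynomial of $\mathbf M_\sigma$ is irreducible and the maximal eigenvalue $\beta$ of $\mathbf M_\sigma$ is a Pisot number. Let $\mathbf u_\beta$ and $\mathbf v_\beta$ be eigenvectors with positive entries, for the eigenvalue $\beta$, of $\mathbf M_\sigma$ and of ${}^{\mathrm t}\mathbf M_\sigma$ respectively. The contracting plane $\mathcal P_{\mathrm c}$ is the plane through the origin with normal vector $\mathbf v_\beta$, and $\pi_{\mathrm c}:\mathbb R^3\to\mathcal P_{\mathrm c}$ is the projection onto $\mathcal P_{\mathrm c}$ along $\mathbf u_\beta$. The Rauzy fractal associated with $\sigma$ is the limit, for the Hausdorff distance on compact subsets of $\mathcal P_{\mathrm c}$, of the (convergent) sequence $\mathcal D_n=\mathbf M_\sigma^n\big(\pi_{\mathrm c}(\mathbf E_1^*(\sigma)^n(\mathcal U))\big)$, $n\geq0$. *)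

theory Defs
  imports "HOL-Analysis.Analysis"
begin

text \<open>
  The alphabet is the three-element type \<^typ>\<open>3\<close> of residues modulo 3, whose elements are
  \<^term>\<open>1\<close>, \<^term>\<open>2\<close> and \<^term>\<open>3 = 0\<close>; it is also the index type of
  \<^typ>\<open>real^3\<close>. A substitution is a monoid morphism on words, so products of substitutions are
  compositions of functions.
\<close>

type_synonym word3 = "3 list"

definition arnoux_rauzy :: "3 \<Rightarrow> word3 \<Rightarrow> word3" where
  "arnoux_rauzy i w = concat (map (\<lambda>j. if j = i then [i] else [j, i]) w)"

definition abelianization :: "word3 \<Rightarrow> 'a::semiring_1 ^ 3" where
  "abelianization w = (\<chi> i. of_nat (count_list w i))"

text \<open>
  The incidence matrix is used over the integers (in the dual substitution), over the reals and
  over the complex numbers (for the spectrum), hence the polymorphic entries.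
\<close>

definition incidence_matrix :: "(word3 \<Rightarrow> word3) \<Rightarrow> 'a::semiring_1 ^ 3 ^ 3" where
  "incidence_matrix \<sigma> = (\<chi> i j. of_nat (count_list (\<sigma> [j]) i))"


text \<open>
  The unit face $[x,i]^*$ is encoded by the pair of its base point and its type. Distinct faces of
  the same type meet at most in their boundaries, and faces of different types meet in at most a
  segment, so a union of unit faces determines the set of faces it is made of. The
  action of the dual substitution on unions of faces is therefore an action on sets of pairs, and
  \<open>region\<close> is the corresponding set of points.
\<close>

type_synonym face = "(int ^ 3) \<times> 3"

definition unit_face :: "face \<Rightarrow> (real ^ 3) set" where
  "unit_face = (\<lambda>(x, i). {(\<chi> m. real_of_int (x $ m)) + a *\<^sub>R axis j 1 + b *\<^sub>R axis k 1 | a b j k.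
     a \<in> {0..1} \<and> b \<in> {0..1} \<and> {i, j, k} = {1, 2, 3}})"

definition region :: "face set \<Rightarrow> (real ^ 3) set" where
  "region F = (\<Union>f\<in>F. unit_face f)"

definition initial_faces :: "face set" where
  "initial_faces = {(0, 1), (0, 2), (0, 3)}"

text \<open>
  For unimodular \<open>\<sigma>\<close> the inverse below is the inverse of the incidence matrix over the integers.
\<close>

definition dual_face :: "(word3 \<Rightarrow> word3) \<Rightarrow> face \<Rightarrow> face set" where
  "dual_face \<sigma> = (\<lambda>(x, i). let N = matrix_inv (incidence_matrix \<sigma>) in
     {(N *v x + N *v abelianization s, j) | j p s. \<sigma> [j] = p @ [i] @ s})"

definition dual_substitution :: "(word3 \<Rightarrow> word3) \<Rightarrow> face set \<Rightarrow> face set" where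
  "dual_substitution \<sigma> F = (\<Union>f\<in>F. dual_face \<sigma> f)"


definition eigenvalue :: "'a::field ^ 'n ^ 'n \<Rightarrow> 'a \<Rightarrow> bool" where
  "eigenvalue A c \<longleftrightarrow> (\<exists>x. x \<noteq> 0 \<and> A *v x = c *s x)"

definition maximal_eigenvalue :: "(word3 \<Rightarrow> word3) \<Rightarrow> real \<Rightarrow> bool" where
  "maximal_eigenvalue \<sigma> \<beta> \<longleftrightarrow> eigenvalue (incidence_matrix \<sigma>) \<beta> \<and>
     (\<forall>c::complex. eigenvalue (incidence_matrix \<sigma>) c \<longrightarrow> cmod c \<le> \<beta>)"

definition contracting_plane :: "real ^ 3 \<Rightarrow> (real ^ 3) set" where
  "contracting_plane v = {x. v \<bullet> x = 0}"

definition contracting_proj :: "real ^ 3 \<Rightarrow> real ^ 3 \<Rightarrow> real ^ 3 \<Rightarrow> real ^ 3" where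
  "contracting_proj u v x = x - ((v \<bullet> x) / (v \<bullet> u)) *\<^sub>R u"

lemma contracting_proj_eq_iff:
  assumes "v \<bullet> u \<noteq> 0"
  shows "contracting_proj u v x = y \<longleftrightarrow> y \<in> contracting_plane v \<and> (\<exists>t. x = y + t *\<^sub>R u)"
proof
  assume "contracting_proj u v x = y"
  then have y: "y = x - ((v \<bullet> x) / (v \<bullet> u)) *\<^sub>R u"
    by (simp add: contracting_proj_def)
  have "v \<bullet> y = 0"
    using assms by (simp add: y inner_diff_right)
  moreover have "x = y + ((v \<bullet> x) / (v \<bullet> u)) *\<^sub>R u"
    by (simp add: y)
  ultimately show "y \<in> contracting_plane v \<and> (\<exists>t. x = y + t *\<^sub>R u)"
    unfolding contracting_plane_def by blast
next
  assume "y \<in> contracting_plane v \<and> (\<exists>t. x = y + t *\<^sub>R u)"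
  then obtain t where "v \<bullet> y = 0" "x = y + t *\<^sub>R u"
    by (auto simp: contracting_plane_def)
  then show "contracting_proj u v x = y"
    using assms by (simp add: contracting_proj_def inner_add_right)
qed

definition rauzy_approx :: "(word3 \<Rightarrow> word3) \<Rightarrow> real ^ 3 \<Rightarrow> real ^ 3 \<Rightarrow> nat \<Rightarrow> (real ^ 3) set" where
  "rauzy_approx \<sigma> u v n = (((*v) (incidence_matrix \<sigma>)) ^^ n) `
     (contracting_proj u v ` region ((dual_substitution \<sigma> ^^ n) initial_faces))"

text \<open>Only meaningful for non-empty bounded sets; it is a metric on non-empty compact sets.\<close>

definition hausdorff_distance :: "'a::metric_space set \<Rightarrow> 'a set \<Rightarrow> real" where
  "hausdorff_distance A B = max (SUP a\<in>A. infdist a B) (SUP b\<in>B. infdist b A)"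

definition rauzy_fractal :: "(word3 \<Rightarrow> word3) \<Rightarrow> real ^ 3 \<Rightarrow> real ^ 3 \<Rightarrow> (real ^ 3) set" where
  "rauzy_fractal \<sigma> u v = (THE R. compact R \<and> R \<noteq> {} \<and> R \<subseteq> contracting_plane v \<and>
     (\<lambda>n. hausdorff_distance (rauzy_approx \<sigma> u v n) R) \<longlonglongrightarrow> 0)"

end

theory Submission
  imports Defs
begin

text \<open>
  Write \<open>\<sigma>\<^sub>i\<close> for the Arnoux-Rauzy substitution of the letter \<open>i\<close>. The dual substitution of \<open>\<sigma>\<^sub>i\<close> sends
  \<open>[x,i]\<^sup>*\<close> to a translate of the three faces at the origin and \<open>[x,k]\<^sup>*\<close>, \<open>k \<noteq> i\<close>, to the single face
  \<open>[N x + e\<^sub>i, k]\<^sup>*\<close>, where \<open>N\<close> is the inverse of the incidence matrix \<open>M\<close>.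

  Connectedness: by induction on the word of substitutions, the images of two faces at the same
  base point always touch, hence every patch is connected, and so is the Hausdorff limit.

  Inner point: a face of the stepped surface of \<open>v\<close> has a unique preimage in the next stepped
  surface, so it has a backward orbit. All backward orbits reach the three faces at the origin.
  Indeed the differences of base points along two orbits stay in a set of ``tame'' vectors that is
  invariant under the dynamics; an orbit in a tame position relative to the origin is absorbed
  there; and any two faces are linked by a chain of tame differences. So the patches exhaust the
  stepped surface, whose projection is relatively dense in the contracting plane, and a power of \<open>M\<close> maps
  some ball of the plane into the limit.

  The contraction of the matrix \<open>M\<close> of the product on the plane orthogonal to \<open>v\<close> is obtained by duality: on the plane
  orthogonal to \<open>u\<close> the oscillation \<open>max f - min f\<close> strictly decreases under the transpose.
\<close>

section \<open>The dual Arnoux-Rauzy substitutions\<close>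

text \<open>The matrix of \<open>arnoux_rauzy i\<close> acting on column vectors;
  \<open>bwd i\<close> is its inverse and \<open>tfwd i\<close> its transpose. The ring is left open
  because base points are integral and projections real.\<close>

definition fwd :: "3 \<Rightarrow> 'a::comm_ring_1 ^ 3 \<Rightarrow> 'a ^ 3" where
  "fwd i x = (\<chi> j. if j = i then x $ 1 + x $ 2 + x $ 3 else x $ j)"

definition bwd :: "3 \<Rightarrow> 'a::comm_ring_1 ^ 3 \<Rightarrow> 'a ^ 3" where
  "bwd i x = (\<chi> j. if j = i then 2 * x $ i - (x $ 1 + x $ 2 + x $ 3) else x $ j)"

definition tfwd :: "3 \<Rightarrow> 'a::comm_ring_1 ^ 3 \<Rightarrow> 'a ^ 3" where
  "tfwd i x = (\<chi> j. if j = i then x $ i else x $ j + x $ i)"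

lemma cases_3: obtains "(i::3) = 1" | "i = 2" | "i = 3"
  using exhaust_3 by blast

lemma distinct_3 [simp]: "(1::3) \<noteq> 2" "(1::3) \<noteq> 3" "(2::3) \<noteq> 3" "(2::3) \<noteq> 1" "(3::3) \<noteq> 1" "(3::3) \<noteq> 2"
  by simp_all

lemma fwd_bwd [simp]: "fwd i (bwd i x) = x"
  by (cases i rule: cases_3) (simp_all add: fwd_def bwd_def vec_eq_iff forall_3)

lemma bwd_fwd [simp]: "bwd i (fwd i x) = x"
  by (cases i rule: cases_3) (simp_all add: fwd_def bwd_def vec_eq_iff forall_3)

lemma fwd_add: "fwd i (x + y) = fwd i x + fwd i y"
  by (simp add: fwd_def vec_eq_iff)

lemma bwd_add: "bwd i (x + y) = bwd i x + bwd i y"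
  by (simp add: bwd_def vec_eq_iff algebra_simps)

lemma abelianization_append: "abelianization (s @ t) = abelianization s + abelianization t"
  by (simp add: abelianization_def vec_eq_iff)

lemma abelianization_Nil [simp]: "abelianization [] = 0"
  by (simp add: abelianization_def vec_eq_iff)

lemma abelianization_single: "abelianization [i] = axis i 1"
  by (simp add: abelianization_def vec_eq_iff axis_def)

lemma arnoux_rauzy_append: "arnoux_rauzy i (s @ t) = arnoux_rauzy i s @ arnoux_rauzy i t"
  by (simp add: arnoux_rauzy_def)

lemma arnoux_rauzy_Nil [simp]: "arnoux_rauzy i [] = []"
  by (simp add: arnoux_rauzy_def)

lemma arnoux_rauzy_single: "arnoux_rauzy i [j] = (if j = i then [i] else [j, i])"
  by (simp add: arnoux_rauzy_def)

lemma fwd_axis: "fwd i (axis j 1) = (if j = i then axis i 1 else axis j 1 + axis i 1)"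
  by (cases i rule: cases_3; cases j rule: cases_3) (simp_all add: fwd_def vec_eq_iff forall_3 axis_def)

lemma bwd_axis: "bwd i (axis j 1) = (if j = i then axis i 1 else axis j 1 - axis i 1)"
  by (cases i rule: cases_3; cases j rule: cases_3) (simp_all add: bwd_def vec_eq_iff forall_3 axis_def)

lemma abelianization_arnoux_rauzy:
  "abelianization (arnoux_rauzy i w) = fwd i (abelianization w :: 'a::comm_ring_1 ^ 3)"
proof (induction w)
  case Nil
  then show ?case by (simp add: fwd_def vec_eq_iff)
next
  case (Cons j w)
  have "abelianization (arnoux_rauzy i (j # w)) =
      (abelianization (arnoux_rauzy i [j]) + abelianization (arnoux_rauzy i w) :: 'a ^ 3)"
    by (metis abelianization_append append_Cons append_Nil arnoux_rauzy_append)
  also have "abelianization (arnoux_rauzy i [j]) = fwd i (axis j 1 :: 'a ^ 3)"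
    by (simp add: arnoux_rauzy_single fwd_axis abelianization_single
      abelianization_append [of "[j]" "[i]", simplified])
  also have "fwd i (axis j 1) + abelianization (arnoux_rauzy i w) =
      fwd i (abelianization ([j] @ w) :: 'a ^ 3)"
    by (simp only: Cons fwd_add abelianization_append abelianization_single)
  finally show ?case by simp
qed

section \<open>Products of the substitutions and their incidence matrices\<close>

definition ar_product :: "3 list \<Rightarrow> word3 \<Rightarrow> word3" where
  "ar_product js = foldr (\<circ>) (map arnoux_rauzy js) id"

lemma ar_product_simps [simp]:
  "ar_product [] = id" "ar_product (j # js) = arnoux_rauzy j \<circ> ar_product js"
  by (simp_all add: ar_product_def)

lemma column_incidence_matrix: "column j (incidence_matrix \<sigma>) = abelianization (\<sigma> [j])"
  by (simp add: column_def incidence_matrix_def abelianization_def)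

lemma abelianization_ar_product:
  "abelianization (ar_product js w) = foldr fwd js (abelianization w :: 'a::comm_ring_1 ^ 3)"
  by (induction js) (simp_all add: abelianization_arnoux_rauzy)

lemma foldr_fwd_add: "foldr fwd js (x + y) = foldr fwd js x + foldr fwd js y"
  by (induction js) (simp_all add: fwd_add)

lemma fwd_scale: "fwd i (c *s x) = c *s fwd i x"
  by (simp add: fwd_def vec_eq_iff algebra_simps)

lemma foldr_fwd_scale: "foldr fwd js (c *s x) = c *s foldr fwd js x"
  by (induction js) (simp_all add: fwd_scale)

lemma vec3_decomp: "(x::'a::comm_ring_1 ^ 3) = x $ 1 *s axis 1 1 + x $ 2 *s axis 2 1 + x $ 3 *s axis 3 1"
  by (simp add: vec_eq_iff forall_3 axis_def)

text \<open>Both sides are linear, and the columns of the matrix, the abelianized images of the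
  letters, are the images of the basis vectors under \<open>foldr fwd js\<close>.\<close>

lemma incidence_matrix_ar_product:
  "incidence_matrix (ar_product js) *v x = foldr fwd js (x :: 'a::comm_ring_1 ^ 3)"
proof -
  have "incidence_matrix (ar_product js) *v x = 
     (\<Sum>j\<in>UNIV. x $ j *s (abelianization (ar_product js [j])))"
    by (simp add: matrix_mult_sum column_incidence_matrix)
  also have "\<dots> = foldr fwd js (x $ 1 *s axis 1 1 + x $ 2 *s axis 2 1 + x $ 3 *s axis 3 1)"
    by (simp add: sum_3 abelianization_ar_product abelianization_single foldr_fwd_add foldr_fwd_scale)
  finally show ?thesis using vec3_decomp by metis
qed

lemma invertible_incidence_matrix:
  "invertible (incidence_matrix (ar_product js) :: 'a::comm_ring_1 ^ 3 ^ 3)"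
proof -
  have b: "foldr fwd js (fold bwd js x) = x" "fold bwd js (foldr fwd js x) = x" for x :: "'a ^ 3"
    by (induction js arbitrary: x) simp_all
  have lin: "fold bwd js (x + y) = fold bwd js x + fold bwd js y" for x y :: "'a ^ 3"
    by (induction js arbitrary: x y) (simp_all add: bwd_add)
  have bs: "bwd i (c *s x) = c *s bwd i x" for c and x :: "'a ^ 3" and i
    by (simp add: bwd_def vec_eq_iff algebra_simps)
  have sc: "fold bwd js (c *s x) = c *s fold bwd js x" for c and x :: "'a ^ 3"
    by (induction js arbitrary: x) (simp_all add: bs)
  \<comment> \<open>The matrix of \<open>fold bwd js\<close>: the head of \<open>js\<close>,
    outermost in the product, is undone first.\<close>
  define N :: "'a ^ 3 ^ 3" where "N = (\<chi> i j. fold bwd js (axis j 1) $ i)"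
  have N: "N *v x = fold bwd js x" for x
  proof -
    have "N *v x = (\<Sum>j\<in>UNIV. x $ j *s fold bwd js (axis j 1))"
      by (simp add: matrix_mult_sum N_def column_def)
    also have "\<dots> = fold bwd js (x $ 1 *s axis 1 1 + x $ 2 *s axis 2 1 + x $ 3 *s axis 3 1)"
      by (simp add: sum_3 lin sc)
    finally show ?thesis using vec3_decomp by metis
  qed
  show ?thesis
    unfolding invertible_def
    by (rule exI [of _ N])
      (simp add: matrix_eq N incidence_matrix_ar_product b flip: matrix_vector_mul_assoc)
qed

section \<open>The dual substitution of a product as a sequence of single steps\<close>

lemma matrix_inv_cancel:
  fixes A :: "'a::comm_ring_1 ^ 'n::finite ^ 'n"
  assumes "invertible A"
  shows "A *v (matrix_inv A *v x) = x" "matrix_inv A *v (A *v x) = x"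
proof -
  have "A ** matrix_inv A = mat 1 \<and> matrix_inv A ** A = mat 1"
    using assms unfolding invertible_def matrix_inv_def by (rule someI_ex)
  then show "A *v (matrix_inv A *v x) = x" "matrix_inv A *v (A *v x) = x"
    by (simp_all add: matrix_vector_mul_assoc)
qed

text \<open>Multiplying the equation for the base point by the incidence matrix removes
  \<open>matrix_inv\<close>.\<close>

lemma mem_dual_face_ar_product:
  "(y, j) \<in> dual_face (ar_product js) (x, i) \<longleftrightarrow>
    (\<exists>p s. ar_product js [j] = p @ [i] @ s \<and> foldr fwd js y = x + abelianization s)"
proof -
  let ?A = "incidence_matrix (ar_product js) :: int ^ 3 ^ 3"
  note inv = matrix_inv_cancel [OF invertible_incidence_matrix [of js, where ?'a = int]]
  have "y = matrix_inv ?A *v x + matrix_inv ?A *v abelianization s \<longleftrightarrow>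
      foldr fwd js y = x + abelianization s" for s
    using inv by (metis incidence_matrix_ar_product matrix_vector_right_distrib)
  then show ?thesis
    by (auto simp: dual_face_def Let_def)
qed

text \<open>The dual substitution of \<open>arnoux_rauzy i\<close> in closed form: \<open>i\<close>
  ends the image of every letter, with empty suffix, while \<open>k \<noteq> i\<close> occurs only
  in the image of \<open>k\<close>, before the suffix \<open>[i]\<close>, and \<open>bwd i\<close>
  fixes \<open>axis i 1\<close>.\<close>

definition dual_step :: "3 \<Rightarrow> face set \<Rightarrow> face set" where
  "dual_step i F = (\<Union>(x, k)\<in>F. if k = i then {bwd i x} \<times> UNIV else {(bwd i x + axis i 1, k)})"

text \<open>The image is a concatenation of images of letters, and an occurrence falls into one of
  these blocks. This splitting of suffixes is what makes dual substitutions compose.\<close>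

lemma arnoux_rauzy_split:
  "arnoux_rauzy i w = P @ [k] @ S \<longleftrightarrow>
    (\<exists>p l s p' s'. w = p @ [l] @ s \<and> arnoux_rauzy i [l] = p' @ [k] @ s' \<and>
      P = arnoux_rauzy i p @ p' \<and> S = s' @ arnoux_rauzy i s)"
  (is "?L \<longleftrightarrow> ?R")
proof
  show "?R \<Longrightarrow> ?L"
    by (auto simp: arnoux_rauzy_append simp del: append_Cons append_Nil)
next
  show "?L \<Longrightarrow> ?R"
  proof (induction w arbitrary: P)
    case Nil
    then show ?case by simp
  next
    case (Cons l w)
    have eq: "arnoux_rauzy i [l] @ arnoux_rauzy i w = P @ [k] @ S"
      using Cons.prems by (metis append_Cons append_Nil arnoux_rauzy_append)
    then obtain us where
      "arnoux_rauzy i [l] = P @ us \<and> us @ arnoux_rauzy i w = [k] @ S \<or>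
       arnoux_rauzy i [l] @ us = P \<and> arnoux_rauzy i w = us @ [k] @ S"
      unfolding append_eq_append_conv2 by blast
    \<comment> \<open>An empty overlap means that the occurrence starts right after the first block;
      it is counted as \<open>later\<close>, so that \<open>here\<close> can read \<open>k\<close>
      off the head of \<open>us\<close>.\<close>
    then consider (later) "P = arnoux_rauzy i [l] @ us" "arnoux_rauzy i w = us @ [k] @ S"
      | (here) "arnoux_rauzy i [l] = P @ us" "us \<noteq> []" "us @ arnoux_rauzy i w = [k] @ S"
      by fastforce
    then show ?case
    proof cases
      case later
      from Cons.IH [OF later(2)] obtain p l' s p' s' where
        "w = p @ [l'] @ s" "arnoux_rauzy i [l'] = p' @ [k] @ s'"
        "us = arnoux_rauzy i p @ p'" "S = s' @ arnoux_rauzy i s" by blast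
      moreover have "arnoux_rauzy i (l # p) = arnoux_rauzy i [l] @ arnoux_rauzy i p"
        by (metis append_Cons append_Nil arnoux_rauzy_append)
      ultimately show ?thesis
        using later(1)
        by (intro exI [of _ "l # p"] exI [of _ l'] exI [of _ s] exI [of _ p'] exI [of _ s']) simp
    next
      case here
      then obtain s' where "us = k # s'" by (cases us) auto
      with here show ?thesis
        by (intro exI [of _ "[]"] exI [of _ l] exI [of _ w] exI [of _ P] exI [of _ s']) auto
    qed
  qed
qed

lemma arnoux_rauzy_single_split:
  "arnoux_rauzy i [l] = p @ [k] @ s \<longleftrightarrow>
    k = i \<and> s = [] \<and> p = (if l = i then [] else [l]) \<or> k \<noteq> i \<and> l = k \<and> p = [] \<and> s = [i]"
  by (auto simp: arnoux_rauzy_single append_eq_Cons_conv Cons_eq_append_conv)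

lemma fwd_eq_iff: "fwd i y = x \<longleftrightarrow> y = bwd i x"
  by auto

text \<open>Duality reverses composition: the outermost substitution acts first on faces. The suffix
  in the composed image is \<open>s' @ arnoux_rauzy i s\<close>, and applying \<open>bwd i\<close>
  to the equation for the base point separates the two steps.\<close>

lemma dual_face_ar_product_Cons:
  "dual_face (ar_product (i # js)) (x, k) = dual_substitution (ar_product js) (dual_step i {(x, k)})"
proof -
  have "(y, j) \<in> dual_face (ar_product (i # js)) (x, k) \<longleftrightarrow>
      (\<exists>p l s p' s'. ar_product js [j] = p @ [l] @ s \<and> arnoux_rauzy i [l] = p' @ [k] @ s' \<and>
         foldr fwd js y = bwd i (x + abelianization s') + abelianization s)" (is "_ \<longleftrightarrow> ?R") for y j
  proof -
    have "(y, j) \<in> dual_face (ar_product (i # js)) (x, k) \<longleftrightarrow>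
      (\<exists>p l s p' s'. ar_product js [j] = p @ [l] @ s \<and> arnoux_rauzy i [l] = p' @ [k] @ s' \<and>
         fwd i (foldr fwd js y) = x + abelianization s' + fwd i (abelianization s))"
    proof
      assume "(y, j) \<in> dual_face (ar_product (i # js)) (x, k)"
      then obtain P S where "arnoux_rauzy i (ar_product js [j]) = P @ [k] @ S"
        and *: "fwd i (foldr fwd js y) = x + abelianization S"
        unfolding mem_dual_face_ar_product by (auto simp del: append_Cons append_Nil)
      then obtain p l s p' s' where "ar_product js [j] = p @ [l] @ s"
        "arnoux_rauzy i [l] = p' @ [k] @ s'" "S = s' @ arnoux_rauzy i s"
        using arnoux_rauzy_split [THEN iffD1] by blast
      with * show "\<exists>p l s p' s'. ar_product js [j] = p @ [l] @ s \<and> arnoux_rauzy i [l] = p' @ [k] @ s' \<and>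
         fwd i (foldr fwd js y) = x + abelianization s' + fwd i (abelianization s)"
        by (metis abelianization_append abelianization_arnoux_rauzy add.assoc)
    next
      assume "\<exists>p l s p' s'. ar_product js [j] = p @ [l] @ s \<and> arnoux_rauzy i [l] = p' @ [k] @ s' \<and>
         fwd i (foldr fwd js y) = x + abelianization s' + fwd i (abelianization s)"
      then obtain p l s p' s' where "ar_product js [j] = p @ [l] @ s"
        "arnoux_rauzy i [l] = p' @ [k] @ s'"
        and *: "fwd i (foldr fwd js y) = x + abelianization s' + fwd i (abelianization s)"
        by blast
      then have "arnoux_rauzy i (ar_product js [j]) =
          (arnoux_rauzy i p @ p') @ [k] @ (s' @ arnoux_rauzy i s)"
        by (simp add: arnoux_rauzy_append del: append_Cons append_Nil)
      then show "(y, j) \<in> dual_face (ar_product (i # js)) (x, k)"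
        unfolding mem_dual_face_ar_product using *
        by (intro exI [of _ "arnoux_rauzy i p @ p'"] exI [of _ "s' @ arnoux_rauzy i s"])
          (simp add: abelianization_append abelianization_arnoux_rauzy add.assoc)
    qed
    then show ?thesis
      by (simp add: fwd_eq_iff bwd_add)
  qed
  moreover have "?R y j \<longleftrightarrow> (y, j) \<in> dual_substitution (ar_product js) (dual_step i {(x, k)})" for y j
  proof (cases "k = i")
    case True
    then show ?thesis
      by (auto simp: arnoux_rauzy_single_split dual_substitution_def dual_step_def
        mem_dual_face_ar_product simp del: append_Cons append_Nil)
  next
    case False
    then show ?thesis
      by (auto simp: arnoux_rauzy_single_split dual_substitution_def dual_step_def
        mem_dual_face_ar_product abelianization_single bwd_add bwd_axis simp del: append_Cons append_Nil)
  qed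
  ultimately show ?thesis by auto
qed

lemma dual_step_UN: "dual_step i (\<Union>x\<in>A. B x) = (\<Union>x\<in>A. dual_step i (B x))"
  by (auto simp: dual_step_def)

lemma fold_dual_step_UN: "fold dual_step js (\<Union>x\<in>A. B x) = (\<Union>x\<in>A. fold dual_step js (B x))"
  by (induction js arbitrary: B) (simp_all add: dual_step_UN)

lemma dual_substitution_ar_product: "dual_substitution (ar_product js) F = fold dual_step js F"
proof (induction js arbitrary: F)
  case Nil
  have "(y, j) \<in> dual_face id (x, k) \<longleftrightarrow> (y, j) = (x, k)" for y j x k
    using mem_dual_face_ar_product [of y j "[]" x k] by (auto simp: Cons_eq_append_conv)
  then have "dual_face id f = {f}" for f
    by (cases f) auto
  then show ?case
    by (auto simp: dual_substitution_def id_def)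
next
  case (Cons i js)
  have "dual_face (ar_product (i # js)) f = fold dual_step js (dual_step i {f})" for f
    by (cases f) (simp only: dual_face_ar_product_Cons Cons.IH)
  then have "dual_substitution (ar_product (i # js)) F = (\<Union>f\<in>F. fold dual_step js (dual_step i {f}))"
    by (simp add: dual_substitution_def)
  also have "\<dots> = fold dual_step js (dual_step i (\<Union>f\<in>F. {f}))"
    by (simp only: fold_dual_step_UN dual_step_UN)
  finally show ?case by (simp only: UN_singleton fold_simps)
qed

section \<open>Connectedness of the patches\<close>

definition rvec :: "int ^ 3 \<Rightarrow> real ^ 3" where
  "rvec x = (\<chi> m. real_of_int (x $ m))"

lemma insert_eq_123: "{i, j, k} = {1, 2, 3::3} \<longleftrightarrow> i \<noteq> j \<and> j \<noteq> k \<and> k \<noteq> i"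
  by (cases i rule: cases_3; cases j rule: cases_3; cases k rule: cases_3)
    (simp_all only: set_eq_iff insert_iff empty_iff forall_3 distinct_3 simp_thms)

lemma ex_others_3: "\<exists>j k. i \<noteq> j \<and> j \<noteq> k \<and> k \<noteq> (i::3)"
  by (cases i rule: cases_3) (metis distinct_3)+

lemma ex_other_3: "\<exists>c. c \<noteq> k \<and> c \<noteq> (k'::3)"
  by (cases k rule: cases_3; cases k' rule: cases_3) (metis distinct_3)+

lemma third_3: "k \<noteq> k' \<Longrightarrow> c \<noteq> k \<Longrightarrow> c \<noteq> k' \<Longrightarrow> i = k \<or> i = k' \<or> i = (c::3)"
  by (cases i rule: cases_3; cases k rule: cases_3; cases k' rule: cases_3; cases c rule: cases_3) simp_all

lemma mem_unit_face:
  "p \<in> unit_face (x, i) \<longleftrightarrow>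
     (\<forall>j. if j = i then p $ j = x $ j else real_of_int (x $ j) \<le> p $ j \<and> p $ j \<le> x $ j + 1)"
  (is "?L \<longleftrightarrow> ?R")
proof
  assume ?L
  then have "\<exists>a b j k. p = (\<chi> m. real_of_int (x $ m)) + a *\<^sub>R axis j 1 + b *\<^sub>R axis k 1 \<and>
     a \<in> {0..1} \<and> b \<in> {0..1} \<and> {i, j, k} = {1, 2, 3}"
    by (simp only: unit_face_def case_prod_conv mem_Collect_eq)
  then obtain a b j k where
    p: "p = (\<chi> m. real_of_int (x $ m)) + a *\<^sub>R axis j 1 + b *\<^sub>R axis k 1"
    and ab: "a \<in> {0..1}" "b \<in> {0..1}" and ijk: "i \<noteq> j" "j \<noteq> k" "k \<noteq> i"
    unfolding insert_eq_123 by metis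
  then show ?R
    by (auto simp: axis_def)
next
  assume R: ?R
  obtain j k :: 3 where jk: "i \<noteq> j" "j \<noteq> k" "k \<noteq> i"
    using ex_others_3 by blast
  have "p $ l = ((\<chi> m. real_of_int (x $ m)) + (p $ j - x $ j) *\<^sub>R axis j 1 + (p $ k - x $ k) *\<^sub>R axis k 1) $ l" for l
    using third_3 [of i j k l] R [rule_format, of i] jk by (auto simp: axis_def)
  then have "p = (\<chi> m. real_of_int (x $ m)) + (p $ j - x $ j) *\<^sub>R axis j 1 + (p $ k - x $ k) *\<^sub>R axis k 1"
    unfolding vec_eq_iff by blast
  moreover have "p $ j - x $ j \<in> {0..1}" "p $ k - x $ k \<in> {0..1}"
    using R [rule_format, of j] R [rule_format, of k] jk by auto
  ultimately show ?L
    using jk unfolding unit_face_def insert_eq_123 by blast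
qed

lemma rvec_mem_unit_face: "rvec x \<in> unit_face (x, i)"
  by (simp add: mem_unit_face rvec_def)

lemma convex_unit_face: "convex (unit_face f)"
proof (cases f)
  case (Pair x i)
  have "convex {t. if j = i then t = real_of_int (x $ j) else real_of_int (x $ j) \<le> t \<and> t \<le> x $ j + 1}" for j
  proof (cases "j = i")
    case False
    then have "{t. if j = i then t = real_of_int (x $ j) else real_of_int (x $ j) \<le> t \<and> t \<le> x $ j + 1} =
        {real_of_int (x $ j)..x $ j + 1}"
      by auto
    then show ?thesis by simp
  qed simp
  then have "convex {p. \<forall>j. if j = i then p $ j = real_of_int (x $ j)
      else real_of_int (x $ j) \<le> p $ j \<and> p $ j \<le> x $ j + 1}"
    by (rule convex_box_cart)
  moreover have "unit_face f = {p. \<forall>j. if j = i then p $ j = real_of_int (x $ j)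
      else real_of_int (x $ j) \<le> p $ j \<and> p $ j \<le> x $ j + 1}"
    unfolding set_eq_iff mem_Collect_eq Pair mem_unit_face by blast
  ultimately show ?thesis by simp
qed

lemma region_mono: "F \<subseteq> G \<Longrightarrow> region F \<subseteq> region G"
  by (auto simp: region_def)

lemma region_Un: "region (F \<union> G) = region F \<union> region G"
  by (auto simp: region_def)

lemma region_single [simp]: "region {f} = unit_face f"
  by (simp add: region_def)

lemma dual_step_mono: "F \<subseteq> G \<Longrightarrow> dual_step i F \<subseteq> dual_step i G"
  by (auto simp: dual_step_def)

lemma fold_dual_step_mono: "F \<subseteq> G \<Longrightarrow> fold dual_step w F \<subseteq> fold dual_step w G"
  by (induction w arbitrary: F G) (simp_all add: dual_step_mono)

lemma fold_dual_step_Un: "fold dual_step w (F \<union> G) = fold dual_step w F \<union> fold dual_step w G"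
proof (induction w arbitrary: F G)
  case (Cons i w)
  have "dual_step i (F \<union> G) = dual_step i F \<union> dual_step i G"
    by (auto simp: dual_step_def)
  then show ?case by (simp add: Cons)
qed simp

section \<open>Contact between the iterated images of neighbouring faces\<close>

definition touch :: "3 list \<Rightarrow> face set \<Rightarrow> face set \<Rightarrow> bool" where
  "touch w F G \<longleftrightarrow> region (fold dual_step w F) \<inter> region (fold dual_step w G) \<noteq> {}"

lemma touch_Cons: "touch (i # w) F G = touch w (dual_step i F) (dual_step i G)"
  by (simp add: touch_def)

lemma touch_sym: "touch w F G \<Longrightarrow> touch w G F"
  by (auto simp: touch_def)

lemma touch_mono: "touch w F G \<Longrightarrow> F \<subseteq> F' \<Longrightarrow> G \<subseteq> G' \<Longrightarrow> touch w F' G'"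
  unfolding touch_def
  using region_mono [OF fold_dual_step_mono, of F F' w] region_mono [OF fold_dual_step_mono, of G G' w]
  by blast

lemma touch_Nil: "p \<in> unit_face f \<Longrightarrow> p \<in> unit_face g \<Longrightarrow> f \<in> F \<Longrightarrow> g \<in> G \<Longrightarrow> touch [] F G"
  by (auto simp: touch_def region_def)

lemma dual_step_same: "dual_step i {(x, i)} = {bwd i x} \<times> UNIV"
  by (simp add: dual_step_def)

lemma dual_step_other: "k \<noteq> i \<Longrightarrow> dual_step i {(x, k)} = {(bwd i x + axis i 1, k)}"
  by (simp add: dual_step_def)

text \<open>
  The three adjacency types are closed under the dual substitutions. In the third one the faces
  share the vertex opposite to their base points, and this is preserved forever.
\<close>

lemma touch_adjacent:
  "k \<noteq> k' \<Longrightarrow> touch w {(x, k)} {(x, k')}"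
  "k \<noteq> k' \<Longrightarrow> c \<noteq> k \<Longrightarrow> c \<noteq> k' \<Longrightarrow> touch w {(x, k'), (x, c)} {(x + axis k 1, k')}"
  "k \<noteq> k' \<Longrightarrow> touch w {(x + axis k 1, k)} {(x + axis k' 1, k')}"
proof (induction w arbitrary: x k k' c)
  case Nil
  {
    case 1
    show ?case
      by (rule touch_Nil [of "rvec x"]) (auto simp: rvec_mem_unit_face)
  next
    case 2
    then show ?case
      by (intro touch_Nil [of "rvec (x + axis k 1)" "(x, k')" "(x + axis k 1, k')"])
        (auto simp: rvec_mem_unit_face mem_unit_face rvec_def axis_def)
  next
    case 3
    then show ?case
      by (intro touch_Nil [of "rvec (x + axis k 1 + axis k' 1)"])
        (auto simp: mem_unit_face rvec_def axis_def)
  }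
next
  case (Cons i w)
  \<comment> \<open>The full star at \<open>y\<close> contains the two faces needed for the second
    adjacency type.\<close>
  have T1: "touch w ({y} \<times> UNIV) {(y + axis k 1, k')}" if kk: "k \<noteq> k'" for y k k'
  proof -
    obtain c where "c \<noteq> k" "c \<noteq> k'"
      using ex_other_3 by blast
    from Cons.IH(2) [OF kk this] show ?thesis
      by (rule touch_mono) auto
  qed
  {
    case 1
    consider "i = k" | "i = k'" | "k \<noteq> i" "k' \<noteq> i" by blast
    then show ?case
    proof cases
      case 1
      with T1 \<open>k \<noteq> k'\<close> show ?thesis
        by (simp add: touch_Cons dual_step_same dual_step_other)
    next
      case 2
      with T1 [of k' k] \<open>k \<noteq> k'\<close> show ?thesis
        by (simp add: touch_Cons dual_step_same dual_step_other touch_sym)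
    next
      case 3
      with Cons.IH(1) \<open>k \<noteq> k'\<close> show ?thesis
        by (simp add: touch_Cons dual_step_other)
    qed
  next
    case 2
    note kc = 2
    consider "i = k" | "i = k'" | "i = c" using third_3 [OF kc] by blast
    then show ?case
    proof cases
      case 1
      have "touch w {(bwd i x + axis k 1, k'), (bwd i x + axis k 1, c)} {(bwd i x + axis k 1 + axis k 1, k')}"
        by (rule Cons.IH(2) [OF kc])
      moreover have "dual_step i {(x, k'), (x, c)} = {(bwd i x + axis k 1, k'), (bwd i x + axis k 1, c)}"
        using 1 kc by (auto simp: dual_step_def)
      ultimately show ?thesis
        using 1 kc by (simp add: touch_Cons dual_step_other bwd_add bwd_axis)
    next
      case 2
      \<comment> \<open>Both faces of type \<open>k'\<close> become stars, at \<open>bwd i x\<close>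
        and at \<open>bwd i x + axis k 1 - axis k' 1\<close>. One face of each gives a pair of the
        third type over \<open>bwd i x - axis k' 1\<close>.\<close>
      have "touch w {(bwd i x - axis k' 1 + axis k' 1, k')} {(bwd i x - axis k' 1 + axis k 1, k)}"
        using kc(1) by (intro Cons.IH(3)) auto
      then show ?thesis
        unfolding touch_Cons using 2 kc
        by (rule_tac touch_mono) (auto simp: dual_step_def bwd_add bwd_axis)
    next
      case 3
      have "touch w ({bwd i x} \<times> UNIV) {(bwd i x + axis k 1, k')}"
        by (rule T1) fact
      then show ?thesis
        unfolding touch_Cons using 3 kc
        by (rule_tac touch_mono) (auto simp: dual_step_def bwd_add bwd_axis)
    qed
  next
    case 3
    \<comment> \<open>The same pair serves for every \<open>i\<close>: when \<open>i\<close> differs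
      from the type of a face, the added \<open>axis i 1\<close> cancels the correction in
      \<open>bwd_axis\<close>.\<close>
    have "touch w {(bwd i x + axis k 1, k)} {(bwd i x + axis k' 1, k')}"
      using 3 by (rule Cons.IH(3))
    then show ?case
      unfolding touch_Cons using 3
      by (rule_tac touch_mono) (auto simp: dual_step_def bwd_add bwd_axis)
  }
qed

lemma connected_dual_star:
  assumes "\<And>k. connected (region (fold dual_step w {(x, k)}))"
  shows "connected (region (fold dual_step w ({x} \<times> UNIV)))"
proof -
  have t: "region (fold dual_step w {(x, k)}) \<inter> region (fold dual_step w {(x, k')}) \<noteq> {}" if "k \<noteq> k'" for k k'
    using touch_adjacent(1) [OF that] by (simp add: touch_def)
  have U: "{x} \<times> UNIV = {(x, 1::3)} \<union> {(x, 2)} \<union> {(x, 3)}"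
    unfolding UNIV_3 by auto
  have "connected (region (fold dual_step w {(x, 1)}) \<union> region (fold dual_step w {(x, 2)}))"
    using assms t by (intro connected_Un) auto
  then show ?thesis
    unfolding U fold_dual_step_Un region_Un using assms t [of 2 3]
    by (rule_tac connected_Un) auto
qed

lemma connected_region_fold_dual_step: "connected (region (fold dual_step w {(x, k)}))"
proof (induction w arbitrary: x k)
  case Nil
  then show ?case by (simp add: convex_connected convex_unit_face)
next
  case (Cons i w)
  then show ?case
    using connected_dual_star by (cases "k = i") (auto simp: dual_step_same dual_step_other)
qed

lemma initial_faces_eq: "initial_faces = {0} \<times> UNIV"
  unfolding initial_faces_def UNIV_3 by auto

lemma connected_region_initial: "connected (region (fold dual_step w initial_faces))"
  unfolding initial_faces_eq by (intro connected_dual_star connected_region_fold_dual_step)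

section \<open>Backward orbits on stepped surfaces\<close>

text \<open>The discrete plane approximating the plane orthogonal to \<open>v\<close>. The half-open
  range of heights singles out one preimage of each face.\<close>

definition stepped_faces :: "real ^ 3 \<Rightarrow> face set" where
  "stepped_faces v = {(y, j). 0 \<le> v \<bullet> rvec y \<and> v \<bullet> rvec y < v $ j}"

text \<open>
  The face of the stepped surface of \<open>w\<close>, where \<open>v = tfwd i w\<close>, whose dual image contains the given
  face of the stepped surface of \<open>v\<close>. Note \<open>w $ i = v $ i\<close>.
\<close>

definition pre_shift :: "3 \<Rightarrow> real ^ 3 \<Rightarrow> face \<Rightarrow> int" where
  "pre_shift i v = (\<lambda>(y, j). if j = i \<or> v \<bullet> rvec y < v $ i then 0 else 1)"

lemma pre_shift_01: "pre_shift i v f = 0 \<or> pre_shift i v f = 1"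
  by (simp add: pre_shift_def split: prod.split)

text \<open>Solving \<open>(y, j) \<in> dual_step i {(x, k)}\<close> for \<open>(x, k)\<close>:
  either \<open>k = i\<close> and \<open>x = fwd i y\<close>, or \<open>k = j\<close>,
  \<open>j \<noteq> i\<close> and one \<open>axis i 1\<close> is subtracted. By
  \<open>inner_fwd\<close> the height is kept in the first case and drops by \<open>w $ i\<close> in
  the second, so the height decides.\<close>

definition pre_face :: "3 \<Rightarrow> real ^ 3 \<Rightarrow> face \<Rightarrow> face" where
  "pre_face i v = (\<lambda>(y, j). (fwd i y - pre_shift i v (y, j) *s axis i 1,
     if pre_shift i v (y, j) = 0 then i else j))"

lemma inner_vec3: "(x :: real ^ 3) \<bullet> y = x $ 1 * y $ 1 + x $ 2 * y $ 2 + x $ 3 * y $ 3"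
  by (simp add: inner_vec_def sum_3)

lemma inner_fwd: "w \<bullet> fwd i x = tfwd i w \<bullet> (x :: real ^ 3)"
  by (cases i rule: cases_3) (simp_all add: inner_vec3 fwd_def tfwd_def algebra_simps)

lemma rvec_simps:
  "rvec (x + y) = rvec x + rvec y" "rvec (x - y) = rvec x - rvec y"
  "rvec (c *s x) = of_int c *\<^sub>R rvec x" "rvec (axis i 1) = axis i 1" "rvec 0 = 0"
  "rvec (fwd i x) = fwd i (rvec x)"
  by (simp_all add: rvec_def vec_eq_iff axis_def fwd_def)

lemma pre_face_stepped:
  assumes v: "v = tfwd i w" and pos: "\<And>k. w $ k > 0" and yj: "(y, j) \<in> stepped_faces v"
  shows "pre_face i v (y, j) \<in> stepped_faces w"
proof -
  have vi: "v $ i = w $ i" and vj: "j \<noteq> i \<Longrightarrow> v $ j = w $ j + w $ i"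
    by (simp_all add: v tfwd_def)
  have "w \<bullet> rvec (fwd i y - c *s axis i 1) = v \<bullet> rvec y - c * w $ i" for c
    by (simp add: rvec_simps inner_diff_right inner_fwd v inner_axis)
  then show ?thesis
    using yj vi vj by (auto simp: pre_face_def pre_shift_def stepped_faces_def)
qed

lemma bwd_diff: "bwd i (x - y) = bwd i x - bwd i y"
  by (simp add: bwd_def vec_eq_iff algebra_simps)

lemma bwd_0 [simp]: "bwd i 0 = 0"
  by (simp add: bwd_def vec_eq_iff)

lemma mem_dual_step_pre_face: "f \<in> dual_step i {pre_face i v f}"
  by (cases f) (auto simp: pre_face_def pre_shift_def dual_step_def bwd_axis bwd_diff)

section \<open>Tame difference vectors\<close>

lemma sum_distinct_3:
  "a \<noteq> b \<Longrightarrow> b \<noteq> c \<Longrightarrow> c \<noteq> a \<Longrightarrow> x $ 1 + x $ 2 + x $ 3 = x $ a + x $ b + x $ c" for x :: "'a::comm_monoid_add ^ 3"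
  by (cases a rule: cases_3; cases b rule: cases_3; cases c rule: cases_3)
    (simp_all add: ac_simps)

text \<open>A class symmetric under negation that contains \<open>axis p 1\<close>,
  \<open>- axis q 1\<close> and \<open>axis p 1 - axis q 1\<close> for \<open>p \<noteq> q\<close>,
  and that is not left by \<open>fwd i\<close> followed by an error of at most 1 in coordinate
  \<open>i\<close>.\<close>

definition tame :: "int ^ 3 \<Rightarrow> bool" where
  "tame x \<longleftrightarrow> (\<forall>k. 0 \<le> x $ k) \<or> (\<forall>k. x $ k \<le> 0) \<or>
     (\<exists>p. x $ p = 1 \<and> (\<forall>k. k \<noteq> p \<longrightarrow> x $ k \<le> 0)) \<or> (\<exists>p. x $ p = - 1 \<and> (\<forall>k. k \<noteq> p \<longrightarrow> 0 \<le> x $ k))"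

lemma tame_uminus: "tame (- x) = tame x"
proof -
  have "- t = 1 \<longleftrightarrow> t = - 1" for t :: int by auto
  then show ?thesis by (auto simp: tame_def)
qed

text \<open>Only coordinate \<open>i\<close> changes. For \<open>i = p\<close> it becomes at most 1
  unless the other two vanish. For \<open>i \<noteq> p\<close> it can be positive beside a negative
  \<open>x $ d\<close> only if \<open>x $ d = - 1\<close>, and then the vector has the fourth
  shape.\<close>

lemma tame_fwd_pos:
  assumes "x $ p = 1" "\<And>k. k \<noteq> p \<Longrightarrow> x $ k \<le> 0" and c: "c = -1 \<or> c = 0 \<or> c = 1"
  shows "tame (fwd i x + c *s axis i 1)"
proof -
  let ?z = "fwd i x + c *s axis i 1"
  have other: "?z $ k = x $ k" if "k \<noteq> i" for k
    using that by (simp add: fwd_def axis_def)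
  have letter: "?z $ i = x $ i + x $ b + x $ d + c" if "i \<noteq> b" "b \<noteq> d" "d \<noteq> i" for b d
    using sum_distinct_3 [OF that, of x] by (simp add: fwd_def axis_def)
  show ?thesis
  proof (cases "i = p")
    case True
    obtain b d where bd: "p \<noteq> b" "b \<noteq> d" "d \<noteq> p" using ex_others_3 by blast
    have z: "?z $ p = 1 + x $ b + x $ d + c" "?z $ b = x $ b" "?z $ d = x $ d" "x $ b \<le> 0" "x $ d \<le> 0"
      using True assms bd letter [of b d] other by auto
    show ?thesis
    proof (cases "x $ b = 0 \<and> x $ d = 0")
      case True
      then have "0 \<le> ?z $ k" for k
        using third_3 [of p b d k] bd z c by auto
      then show ?thesis unfolding tame_def by blast
    next
      case False
      show ?thesis
      proof (cases "?z $ p = 1")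
        case True
        have "?z $ k \<le> 0" if "k \<noteq> p" for k
          using third_3 [of p b d k] bd z that by auto
        with True show ?thesis unfolding tame_def by blast
      next
        case ne: False
        have "?z $ k \<le> 0" for k
          using third_3 [of p b d k] bd z False c ne by auto
        then show ?thesis unfolding tame_def by blast
      qed
    qed
  next
    case False
    obtain d where d: "d \<noteq> i" "d \<noteq> p" using ex_other_3 by blast
    have z: "?z $ i = x $ i + 1 + x $ d + c" "?z $ p = 1" "?z $ d = x $ d" "x $ i \<le> 0" "x $ d \<le> 0"
      using False assms d letter [of p d] other by auto
    consider "?z $ i \<le> 0" | "0 \<le> ?z $ i" "x $ d = 0" | "0 < ?z $ i" "x $ d < 0"
      using z by linarith
    then show ?thesis
    proof cases
      case 1
      then have "?z $ k \<le> 0" if "k \<noteq> p" for k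
        using third_3 [OF False d, of k] z that by auto
      with z show ?thesis unfolding tame_def by blast
    next
      case 2
      then have "0 \<le> ?z $ k" for k
        using third_3 [OF False d, of k] z by auto
      then show ?thesis unfolding tame_def by blast
    next
      case 3
      then have "?z $ d = - 1" "0 \<le> ?z $ i"
        using z c by auto
      then have "0 \<le> ?z $ k" if "k \<noteq> d" for k
        using third_3 [OF False d, of k] z that by auto
      with \<open>?z $ d = - 1\<close> show ?thesis unfolding tame_def by blast
    qed
  qed
qed

text \<open>For \<open>x \<noteq> 0\<close> the new coordinate is at least \<open>1 + c\<close>,
  hence nonnegative; for \<open>x = 0\<close> only \<open>c\<close> is left, in a single
  coordinate.\<close>

lemma tame_fwd_nonneg:
  assumes "\<And>k. 0 \<le> x $ k" and c: "c = -1 \<or> c = 0 \<or> c = 1"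
  shows "tame (fwd i x + c *s axis i 1)"
proof -
  let ?z = "fwd i x + c *s axis i 1"
  have other: "?z $ k = x $ k" if "k \<noteq> i" for k
    using that by (simp add: fwd_def axis_def)
  have letter: "?z $ i = x $ 1 + x $ 2 + x $ 3 + c"
    by (simp add: fwd_def axis_def)
  show ?thesis
  proof (cases "x = 0")
    case True
    then have z: "?z $ k = (if k = i then c else 0)" for k
      using letter other [of k] by auto
    consider "0 \<le> c" | "c \<le> 0" by linarith
    then have "(\<forall>k. 0 \<le> ?z $ k) \<or> (\<forall>k. ?z $ k \<le> 0)"
      unfolding z by cases simp_all
    then show ?thesis unfolding tame_def by blast
  next
    case False
    then obtain l where "x $ l \<noteq> 0" by (auto simp: vec_eq_iff)
    with assms(1) [of l] have "1 \<le> x $ l" by simp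
    then have "1 \<le> x $ 1 + x $ 2 + x $ 3"
      using assms(1) [of 1] assms(1) [of 2] assms(1) [of 3]
      by (cases l rule: cases_3; hypsubst; linarith)
    then have "0 \<le> ?z $ k" for k
      using letter other [of k] assms(1) [of k] c by (cases "k = i") auto
    then show ?thesis unfolding tame_def by blast
  qed
qed

lemma tame_fwd:
  assumes "tame x" and c: "c = -1 \<or> c = 0 \<or> c = 1"
  shows "tame (fwd i x + c *s axis i 1)"
proof -
  have eq: "fwd i x + c *s axis i 1 = - (fwd i (- x) + (- c) *s axis i 1)"
    by (simp add: fwd_def vec_eq_iff)
  have c': "- c = -1 \<or> - c = 0 \<or> - c = 1" using c by auto
  from assms(1) show ?thesis
    unfolding tame_def [of x]
  proof (elim disjE exE conjE)
    assume "\<forall>k. x $ k \<le> 0"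
    then show ?thesis
      unfolding eq tame_uminus by (intro tame_fwd_nonneg c') simp
  next
    fix p assume "x $ p = - 1" "\<forall>k. k \<noteq> p \<longrightarrow> 0 \<le> x $ k"
    then show ?thesis
      unfolding eq tame_uminus by (intro tame_fwd_pos [of _ p] c') simp_all
  qed (use tame_fwd_nonneg tame_fwd_pos c in blast)+
qed

text \<open>The letters \<open>a n\<close> and normals \<open>w n\<close> met by successive
  preimages, one letter at a time; the \<open>n\<close>-th preimage lies on the stepped surface of
  \<open>w n\<close>. Recurrence ensures that every coordinate is updated again and again.\<close>

locale directive =
  fixes a :: "nat \<Rightarrow> 3" and w :: "nat \<Rightarrow> real ^ 3"
  assumes w_pos: "w n $ k > 0"
    and w_step: "w n = tfwd (a n) (w (Suc n))"
    and recurrent: "\<exists>m\<ge>n. a m = k"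
begin

section \<open>Orbits of preimages and their absorption at the origin\<close>

primrec orbit :: "face \<Rightarrow> nat \<Rightarrow> face" where
  "orbit f 0 = f"
| "orbit f (Suc n) = pre_face (a n) (w n) (orbit f n)"

lemma orbit_stepped: "f \<in> stepped_faces (w 0) \<Longrightarrow> orbit f n \<in> stepped_faces (w n)"
proof (induction n)
  case (Suc n)
  then show ?case
    using pre_face_stepped [OF w_step w_pos] by (cases "orbit f n") simp
qed simp

text \<open>\<open>m\<close> is the first index from \<open>n\<close> on with letter
  \<open>c\<close>, so only steps with other letters must preserve \<open>P\<close>. The absorption
  arguments run an invariant up to such an index.\<close>

lemma eventually_letter:
  assumes "P n" and "\<And>m. m \<ge> n \<Longrightarrow> P m \<Longrightarrow> a m \<noteq> c \<Longrightarrow> P (Suc m)"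
  obtains m where "m \<ge> n" "a m = c" "P m"
proof -
  define m where "m = (LEAST m. m \<ge> n \<and> a m = c)"
  have m: "m \<ge> n" "a m = c"
    unfolding m_def using LeastI_ex [of "\<lambda>m. m \<ge> n \<and> a m = c"] recurrent by blast+
  have "a l \<noteq> c" if "n \<le> l" "l < m" for l
    using that not_less_Least [of l "\<lambda>m. m \<ge> n \<and> a m = c"] unfolding m_def by blast
  then have "k \<le> m - n \<Longrightarrow> P (n + k)" for k
    by (induction k) (use assms in auto)
  from this [of "m - n"] m that show thesis by simp
qed

lemma fst_orbit_Suc:
  "fst (orbit f (Suc n)) =
    fwd (a n) (fst (orbit f n)) - pre_shift (a n) (w n) (orbit f n) *s axis (a n) 1"
  by (simp add: pre_face_def split: prod.split)

context
  fixes f :: face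
  assumes f: "f \<in> stepped_faces (w 0)"
begin

abbreviation "y n \<equiv> fst (orbit f n)"
abbreviation "shift n \<equiv> pre_shift (a n) (w n) (orbit f n)"

lemmas shift_01 = pre_shift_01 [of "a n" "w n" "orbit f n" for n]

lemma y_Suc_other: "k \<noteq> a n \<Longrightarrow> y (Suc n) $ k = y n $ k"
  by (simp add: pre_face_def fwd_def axis_def split: prod.split)

lemmas y_Suc = fst_orbit_Suc [of f]

lemma y_Suc_letter:
  "a n \<noteq> b \<Longrightarrow> b \<noteq> c \<Longrightarrow> c \<noteq> a n \<Longrightarrow> y (Suc n) $ a n = y n $ a n + y n $ b + y n $ c - shift n"
  using sum_distinct_3 [of "a n" b c "y n"]
  unfolding y_Suc by (simp add: fwd_def axis_def)

lemma height: "0 \<le> w n \<bullet> rvec (y n)" "w n \<bullet> rvec (y n) < w n $ snd (orbit f n)"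
  using orbit_stepped [OF f, of n] by (auto simp: stepped_faces_def)

lemma shift_1:
  assumes "w n $ a n \<le> w n \<bullet> rvec (y n)"
  shows "shift n = 1"
  using height(2) [of n] assms by (auto simp: pre_shift_def split: prod.splits)

text \<open>The weights \<open>w n\<close> are positive, so the height would be at most 0, while
  heights on the surface are nonnegative.\<close>

lemma nonpos_imp_zero:
  assumes "\<And>k. y n $ k \<le> 0"
  shows "y n = 0"
proof -
  have *: "w n $ l * rvec (y n) $ l \<le> 0" for l
    using assms [of l] w_pos [of n l] by (simp add: rvec_def mult_le_0_iff less_imp_le)
  have "w n $ l * rvec (y n) $ l = 0" for l
    using height(1) [of n] * [of 1] * [of 2] * [of 3] unfolding inner_vec3
    by (cases l rule: cases_3; hypsubst; linarith)
  then have "y n $ l = 0" for l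
    using w_pos [of n l] by (simp add: rvec_def) (metis less_irrefl)
  then show ?thesis by (simp add: vec_eq_iff)
qed

lemma not_all_pos: "\<exists>k. y n $ k \<le> 0"
proof (rule ccontr)
  assume "\<not> ?thesis"
  then have "1 \<le> rvec (y n) $ l" for l
    by (simp add: rvec_def not_le) (metis int_one_le_iff_zero_less of_int_1 of_int_le_iff)
  then have *: "w n $ l * 1 \<le> w n $ l * rvec (y n) $ l" for l
    using w_pos [of n l] by (intro mult_left_mono) auto
  have "w n $ l \<le> w n \<bullet> rvec (y n)" for l
    using * [of 1] * [of 2] * [of 3] w_pos [of n 1] w_pos [of n 2] w_pos [of n 3] unfolding inner_vec3
    by (cases l rule: cases_3; hypsubst; linarith)
  with height(2) [of n] show False
    by (metis not_le)
qed

text \<open>Steps with letters \<open>p\<close> and \<open>q\<close> keep both coordinates at least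
  1, as a sum of at least 2 loses at most 1. The first step with the third letter makes all
  coordinates positive, against \<open>not_all_pos\<close>.\<close>

lemma not_two_pos:
  assumes "p \<noteq> q" "y n $ p \<ge> 1" "y n $ q \<ge> 1" "\<And>k. y n $ k \<ge> 0"
  shows False
proof -
  obtain c where c: "c \<noteq> p" "c \<noteq> q" using ex_other_3 by blast
  define P where "P m \<longleftrightarrow> y m $ p \<ge> 1 \<and> y m $ q \<ge> 1 \<and> y m $ c \<ge> 0" for m
  have "P n" using assms by (simp add: P_def)
  moreover have "P (Suc m)" if "P m" "a m \<noteq> c" for m
    using third_3 [OF \<open>p \<noteq> q\<close> c, of "a m"] that assms(1) c y_Suc_other [of _ m] shift_01 [of m]
      y_Suc_letter [of m q c] y_Suc_letter [of m p c] unfolding P_def by auto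
  ultimately obtain m where m: "m \<ge> n" "a m = c" "P m"
    using eventually_letter [of P] by blast
  then have "y (Suc m) $ k \<ge> 1" for k
    using third_3 [OF \<open>p \<noteq> q\<close> c, of k] assms(1) c y_Suc_other [of _ m] shift_01 [of m]
      y_Suc_letter [of m p q] unfolding P_def by auto
  with not_all_pos [of "Suc m"] show False
    by (metis not_one_le_zero order_trans)
qed

text \<open>Until the next letter \<open>p\<close> the other coordinates stay 0 by
  \<open>not_two_pos\<close>. At that letter the height is at least \<open>w m $ p\<close>, so the
  shift is 1 and the multiple drops by one.\<close>

lemma reach_multiple:
  assumes "y n $ p = int S" "\<And>k. k \<noteq> p \<Longrightarrow> y n $ k = 0"
  shows "\<exists>m. y m = 0"
  using assms
proof (induction S arbitrary: n)
  case 0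
  then have "y n = 0"
    by (auto simp: vec_eq_iff) (metis of_nat_0)
  then show ?case by blast
next
  case (Suc S)
  define P where "P m \<longleftrightarrow> y m $ p = 1 + int S \<and> (\<forall>k. k \<noteq> p \<longrightarrow> y m $ k = 0)" for m
  have "P n" using Suc.prems by (simp add: P_def)
  moreover have "P (Suc m)" if P: "P m" and am: "a m \<noteq> p" for m
  proof -
    obtain c where c: "c \<noteq> a m" "c \<noteq> p" using ex_other_3 by blast
    have *: "y (Suc m) $ a m = 1 + int S - shift m" "y (Suc m) $ p = 1 + int S" "y (Suc m) $ c = 0"
      using P am c y_Suc_letter [of m p c] y_Suc_other [of _ m] by (auto simp: P_def)
    have nn: "y (Suc m) $ k \<ge> 0" for k
      using third_3 [OF am c, of k] * shift_01 [of m] by auto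
    have "\<not> y (Suc m) $ a m \<ge> 1"
      using not_two_pos [OF am, of "Suc m"] nn * by auto
    then have "y (Suc m) $ k = 0" if "k \<noteq> p" for k
      using third_3 [OF am c, of k] that * nn [of "a m"] by auto
    with * show ?thesis by (auto simp: P_def)
  qed
  ultimately obtain m where m: "a m = p" "P m"
    using eventually_letter [of P] by metis
  obtain b c where bc: "p \<noteq> b" "b \<noteq> c" "c \<noteq> p" using ex_others_3 by blast
  have "w m \<bullet> rvec (y m) = w m $ p * (1 + S)"
    using m(2) bc unfolding inner_vec3 P_def rvec_def by (cases p rule: cases_3) auto
  also have "\<dots> \<ge> w m $ p"
    using w_pos [of m p] by (simp add: algebra_simps)
  finally have "shift m = 1"
    using m(1) by (intro shift_1) simp
  then have "y (Suc m) $ p = int S" "\<And>k. k \<noteq> p \<Longrightarrow> y (Suc m) $ k = 0"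
    using m bc y_Suc_letter [of m b c] y_Suc_other [of _ m] by (auto simp: P_def)
  then show ?case by (rule Suc.IH)
qed

lemma reach_nonneg:
  assumes nn: "\<And>k. y n $ k \<ge> 0"
  shows "\<exists>m. y m = 0"
proof (cases "\<exists>p. y n $ p \<ge> 1")
  case True
  then obtain p where p: "y n $ p \<ge> 1" by blast
  then have "\<not> y n $ k \<ge> 1" if "k \<noteq> p" for k
    using not_two_pos [of k p n] nn that by blast
  then have "y n $ k = 0" if "k \<noteq> p" for k
    using nn [of k] that by force
  moreover have "y n $ p = int (nat (y n $ p))"
    using p by simp
  ultimately show ?thesis
    by (intro reach_multiple)
next
  case False
  then have "y n $ k \<le> 0" for k
    by (meson int_one_le_iff_zero_less not_le)
  then show ?thesis
    using nonpos_imp_zero by blast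
qed

text \<open>If another coordinate became positive, the vector would be nonnegative and
  \<open>reach_nonneg\<close> would apply. So the shape persists until letter \<open>p\<close>,
  whose step makes coordinate \<open>p\<close> nonpositive too, and \<open>nonpos_imp_zero\<close>
  gives the origin.\<close>

lemma reach_one_pos:
  assumes "y n $ p = 1" "\<And>k. k \<noteq> p \<Longrightarrow> y n $ k \<le> 0"
  shows "\<exists>m. y m = 0"
proof (rule ccontr)
  assume contra: "\<not> ?thesis"
  define P where "P m \<longleftrightarrow> y m $ p = 1 \<and> (\<forall>k. k \<noteq> p \<longrightarrow> y m $ k \<le> 0)" for m
  have "P n" using assms by (simp add: P_def)
  moreover have "P (Suc m)" if P: "P m" and am: "a m \<noteq> p" for m
  proof -
    obtain c where c: "c \<noteq> a m" "c \<noteq> p" using ex_other_3 by blast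
    have *: "y (Suc m) $ a m = y m $ a m + 1 + y m $ c - shift m"
      "y (Suc m) $ p = 1" "y (Suc m) $ c = y m $ c"
      and le: "y m $ a m \<le> 0" "y m $ c \<le> 0"
      using P am c y_Suc_letter [of m p c] y_Suc_other [of _ m] by (auto simp: P_def)
    have "y (Suc m) $ a m \<le> 0"
    proof (rule ccontr)
      assume "\<not> ?thesis"
      with * le shift_01 [of m] have "y (Suc m) $ k \<ge> 0" for k
        using third_3 [OF am c, of k] by auto
      then show False using reach_nonneg contra by blast
    qed
    then have "y (Suc m) $ k \<le> 0" if "k \<noteq> p" for k
      using third_3 [OF am c, of k] that * le by auto
    with * show ?thesis by (auto simp: P_def)
  qed
  ultimately obtain m where m: "a m = p" "P m"
    using eventually_letter [of P] by metis
  obtain b c where bc: "p \<noteq> b" "b \<noteq> c" "c \<noteq> p" using ex_others_3 by blast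
  have *: "y (Suc m) $ p = 1 + y m $ b + y m $ c - shift m"
      "y (Suc m) $ b = y m $ b" "y (Suc m) $ c = y m $ c"
      and le: "y m $ b \<le> 0" "y m $ c \<le> 0"
    using m bc y_Suc_letter [of m b c] y_Suc_other [of _ m] by (auto simp: P_def)
  have "y m $ k \<ge> 0" if "y m $ b = 0" "y m $ c = 0" for k
    using third_3 [of p b c k] m(2) bc that by (auto simp: P_def)
  then have "\<not> (y m $ b = 0 \<and> y m $ c = 0)"
    using reach_nonneg contra by blast
  then have "y (Suc m) $ k \<le> 0" for k
    using third_3 [of p b c k] bc * le shift_01 [of m] by auto
  then have "y (Suc m) = 0"
    by (rule nonpos_imp_zero)
  with contra show False by blast
qed

text \<open>The vector is unchanged until letter \<open>b\<close>, since the other value of the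
  shift leads to \<open>reach_nonneg\<close> or \<open>reach_one_pos\<close>. At letter
  \<open>b\<close> the coordinate 1 is replaced by minus the shift.\<close>

lemma reach_difference:
  assumes pb: "p \<noteq> b" and "y n = axis b 1 - axis p 1"
  shows "\<exists>m. y m = 0"
proof (rule ccontr)
  assume contra: "\<not> ?thesis"
  obtain c where c: "c \<noteq> p" "c \<noteq> b" using ex_other_3 by blast
  define P where "P m \<longleftrightarrow> y m $ p = - 1 \<and> y m $ b = 1 \<and> y m $ c = 0" for m
  have "P n" using assms c by (simp add: P_def axis_def)
  moreover have "P (Suc m)" if P: "P m" and am: "a m \<noteq> b" for m
  proof -
    consider "a m = p" | "a m = c"
      using third_3 [OF pb c, of "a m"] am by blast
    then show ?thesis
    proof cases
      case 1
      then have *: "y (Suc m) $ p = - shift m" "y (Suc m) $ b = 1" "y (Suc m) $ c = 0"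
        using P pb c y_Suc_letter [of m b c] y_Suc_other [of _ m] by (auto simp: P_def)
      have "shift m \<noteq> 0"
      proof
        assume "shift m = 0"
        then have "y (Suc m) $ k \<ge> 0" for k
          using third_3 [OF pb c, of k] * by auto
        then show False using reach_nonneg contra by blast
      qed
      then show ?thesis
        using * shift_01 [of m] by (auto simp: P_def)
    next
      case 2
      then have *: "y (Suc m) $ p = - 1" "y (Suc m) $ b = 1" "y (Suc m) $ c = - shift m"
        using P pb c y_Suc_letter [of m p b] y_Suc_other [of _ m] by (auto simp: P_def)
      have "shift m \<noteq> 1"
      proof
        assume "shift m = 1"
        then have "y (Suc m) $ k \<le> 0" if "k \<noteq> b" for k
          using third_3 [OF pb c, of k] * that by auto
        then show False using reach_one_pos [of "Suc m" b] * contra by blast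
      qed
      then show ?thesis
        using * shift_01 [of m] by (auto simp: P_def)
    qed
  qed
  ultimately obtain m where m: "a m = b" "P m"
    using eventually_letter [of P] by metis
  have "y (Suc m) $ k \<le> 0" for k
    using third_3 [OF pb c, of k] m pb c y_Suc_letter [of m p c] y_Suc_other [of _ m] shift_01 [of m]
    by (auto simp: P_def)
  then have "y (Suc m) = 0"
    by (rule nonpos_imp_zero)
  with contra show False by blast
qed

text \<open>The coordinates other than \<open>p\<close> sum to at least 1, or the vector would be
  nonpositive; so an updated coordinate is at least - 1. For a letter other than \<open>p\<close>
  the value - 1 falls under earlier cases. At letter \<open>p\<close> it leaves a difference of two
  basis vectors, and any other value a nonnegative vector.\<close>

lemma reach_one_neg:
  assumes "y n $ p = - 1" "\<And>k. k \<noteq> p \<Longrightarrow> y n $ k \<ge> 0"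
  shows "\<exists>m. y m = 0"
proof (rule ccontr)
  assume contra: "\<not> ?thesis"
  define P where "P m \<longleftrightarrow> y m $ p = - 1 \<and> (\<forall>k. k \<noteq> p \<longrightarrow> y m $ k \<ge> 0)" for m
  have some_pos: False if "P m" "\<And>k. k \<noteq> p \<Longrightarrow> y m $ k = 0" for m
  proof -
    have "y m $ k \<le> 0" for k
      using that by (cases "k = p") (auto simp: P_def)
    then show False using nonpos_imp_zero contra by blast
  qed
  have "P n" using assms by (simp add: P_def)
  moreover have "P (Suc m)" if P: "P m" and am: "a m \<noteq> p" for m
  proof -
    obtain c where c: "c \<noteq> a m" "c \<noteq> p" using ex_other_3 by blast
    have *: "y (Suc m) $ a m = y m $ a m - 1 + y m $ c - shift m"
      "y (Suc m) $ p = - 1" "y (Suc m) $ c = y m $ c"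
      and ge: "y m $ a m \<ge> 0" "y m $ c \<ge> 0"
      using P am c y_Suc_letter [of m p c] y_Suc_other [of _ m] by (auto simp: P_def)
    have "\<not> (y m $ a m = 0 \<and> y m $ c = 0)"
      using some_pos [OF P] third_3 [OF am c] by metis
    with * ge have sum: "y m $ a m + y m $ c \<ge> 1" by linarith
    have "y (Suc m) $ a m \<ge> 0"
    proof (rule ccontr)
      assume neg: "\<not> ?thesis"
      with * sum shift_01 [of m] have eq: "y (Suc m) $ a m = - 1" "y m $ a m + y m $ c = 1" by auto
      show False
      proof (cases "y m $ c = 0")
        case True
        then have "y (Suc m) $ k \<le> 0" for k
          using third_3 [OF am c, of k] * eq by auto
        then show False using nonpos_imp_zero contra by blast
      next
        case False
        then have c1: "y (Suc m) $ c = 1" using * eq ge by auto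
        moreover have "y (Suc m) $ k \<le> 0" if "k \<noteq> c" for k
          using third_3 [OF am c, of k] * eq that by auto
        ultimately show False using reach_one_pos [of "Suc m" c] contra by blast
      qed
    qed
    then have "y (Suc m) $ k \<ge> 0" if "k \<noteq> p" for k
      using third_3 [OF am c, of k] that * ge by auto
    with * show ?thesis by (auto simp: P_def)
  qed
  ultimately obtain m where m: "a m = p" "P m"
    using eventually_letter [of P] by metis
  obtain b c where bc: "p \<noteq> b" "b \<noteq> c" "c \<noteq> p" using ex_others_3 by blast
  have *: "y (Suc m) $ p = y m $ b + y m $ c - 1 - shift m"
      "y (Suc m) $ b = y m $ b" "y (Suc m) $ c = y m $ c"
      and ge: "y m $ b \<ge> 0" "y m $ c \<ge> 0"
    using m bc y_Suc_letter [of m b c] y_Suc_other [of _ m] by (auto simp: P_def)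
  have "\<not> (y m $ b = 0 \<and> y m $ c = 0)"
    using some_pos [OF m(2)] third_3 [of p b c] bc by metis
  with * ge have sum: "y m $ b + y m $ c \<ge> 1" by linarith
  show False
  proof (cases "y (Suc m) $ p \<ge> 0")
    case True
    then have "y (Suc m) $ k \<ge> 0" for k
      using third_3 [of p b c k] * bc ge by auto
    then show False using reach_nonneg contra by blast
  next
    case False
    then have eq: "y (Suc m) $ p = - 1" "y m $ b + y m $ c = 1"
      using * sum shift_01 [of m] by auto
    then consider "y m $ b = 1" "y m $ c = 0" | "y m $ c = 1" "y m $ b = 0"
      using ge by linarith
    then show False
    proof cases
      case 1
      then have "y (Suc m) = axis b 1 - axis p 1"
        using * eq bc third_3 [of p b c] by (simp add: vec_eq_iff axis_def) metis
      then show False using reach_difference [of p b "Suc m"] bc contra by blast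
    next
      case 2
      then have "y (Suc m) = axis c 1 - axis p 1"
        using * eq bc third_3 [of p b c] by (simp add: vec_eq_iff axis_def) metis
      then show False using reach_difference [of p c "Suc m"] bc contra by blast
    qed
  qed
qed

lemma reach_tame: "tame (y n) \<Longrightarrow> \<exists>m. y m = 0"
  unfolding tame_def using reach_nonneg nonpos_imp_zero reach_one_pos reach_one_neg by metis

end

text \<open>The map \<open>fwd (a n)\<close> is common to both orbits, and their shifts differ by at
  most 1, which is the error allowed in \<open>tame_fwd\<close>.\<close>

lemma tame_orbit_diff:
  assumes "tame (fst f - fst g)"
  shows "tame (fst (orbit f n) - fst (orbit g n))"
proof (induction n)
  case 0
  then show ?case using assms by simp
next
  case (Suc n)
  let ?s = "\<lambda>f. pre_shift (a n) (w n) (orbit f n)"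
  have "?s g - ?s f = -1 \<or> ?s g - ?s f = 0 \<or> ?s g - ?s f = 1"
    using pre_shift_01 [of "a n" "w n" "orbit f n"] pre_shift_01 [of "a n" "w n" "orbit g n"] by auto
  from tame_fwd [OF Suc this, of "a n"] show ?case
    unfolding fst_orbit_Suc by (rule back_subst [of tame]) (simp add: fwd_def vec_eq_iff algebra_simps)
qed

text \<open>Induction on the l1 norm of the base point. A face with a shorter base point at tame
  difference reaches the origin by induction; at that moment the base point on the orbit of
  \<open>f\<close> is itself tame, and \<open>reach_tame\<close> applies.\<close>

lemma orbit_reaches_zero:
  assumes "f \<in> stepped_faces (w 0)"
  shows "\<exists>m. fst (orbit f m) = 0"
  using assms
proof (induction "nat (\<bar>fst f $ 1\<bar> + \<bar>fst f $ 2\<bar> + \<bar>fst f $ 3\<bar>)" arbitrary: f rule: less_induct)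
  case less
  obtain y j where f: "f = (y, j)" by (cases f)
  define h where "h = w 0 \<bullet> rvec y"
  have h: "0 \<le> h" "h < w 0 $ j"
    using less.prems by (auto simp: f h_def stepped_faces_def)
  have reduce: ?case if tame: "tame (y - y')" and h': "0 \<le> w 0 \<bullet> rvec y'" "w 0 \<bullet> rvec y' < w 0 $ j'"
    and small: "\<bar>y' $ 1\<bar> + \<bar>y' $ 2\<bar> + \<bar>y' $ 3\<bar> < \<bar>y $ 1\<bar> + \<bar>y $ 2\<bar> + \<bar>y $ 3\<bar>" for y' j'
  proof -
    have "\<exists>m. fst (orbit (y', j') m) = 0"
      using small h' by (intro less.hyps) (auto simp: f stepped_faces_def)
    then obtain m where m: "fst (orbit (y', j') m) = 0" by blast
    have "tame (fst (orbit f m) - fst (orbit (y', j') m))"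
      by (rule tame_orbit_diff) (simp add: f tame)
    then show ?thesis
      using reach_tame [OF less.prems] by (simp add: m)
  qed
  show ?case
  proof (cases "\<forall>k. 0 \<le> y $ k")
    case True
    then show ?thesis
      using reach_nonneg [OF less.prems, of 0] by (simp add: f)
  next
    case False
    then obtain q where q: "y $ q < 0" by (auto simp: not_le)
    have "\<exists>p. 0 < y $ p"
    proof (rule ccontr)
      assume "\<not> ?thesis"
      then have "y = 0"
        using nonpos_imp_zero [OF less.prems, of 0] by (simp add: f not_less)
      with q show False by simp
    qed
    then obtain p where p: "0 < y $ p" by blast
    have pq: "p \<noteq> q" using p q by auto
    obtain c where c: "c \<noteq> p" "c \<noteq> q" using ex_other_3 by blast
    have norm: "\<bar>x $ 1\<bar> + \<bar>x $ 2\<bar> + \<bar>x $ 3\<bar> = \<bar>x $ p\<bar> + \<bar>x $ q\<bar> + \<bar>x $ c\<bar>" for x :: "int ^ 3"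
      using sum_distinct_3 [OF pq c(2) [symmetric] c(1), of "\<chi> k. \<bar>x $ k\<bar>"] by simp
    have reduce': ?thesis if "tame (y - y')" "0 \<le> w 0 \<bullet> rvec y'" "w 0 \<bullet> rvec y' < w 0 $ j'"
      and "\<bar>y' $ p\<bar> + \<bar>y' $ q\<bar> + \<bar>y' $ c\<bar> < \<bar>y $ p\<bar> + \<bar>y $ q\<bar> + \<bar>y $ c\<bar>" for y' j'
      using that reduce [of y' j'] unfolding norm by blast
    have t1: "tame (axis p 1)" "tame (- axis q 1)" "tame (axis p 1 - axis q 1)"
      using pq unfolding tame_def by (auto simp: axis_def)
    \<comment> \<open>Coordinate \<open>p\<close> is lowered, coordinate \<open>q\<close> raised, or
      both. The type of the shorter face is free: for \<open>h < w 0 $ p\<close> the height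
      \<open>h - w 0 $ p + w 0 $ q\<close> fits type \<open>q\<close> as soon as it is
      nonnegative.\<close>
    consider "w 0 $ p \<le> h" | "h + w 0 $ q < w 0 $ j" | "h < w 0 $ p" "w 0 $ j \<le> h + w 0 $ q"
      by linarith
    then show ?thesis
    proof cases
      case 1
      show ?thesis
        by (rule reduce' [of "y - axis p 1" j])
          (use 1 h p pq c w_pos [of 0 p] in \<open>auto simp: t1 rvec_simps inner_diff_right inner_axis h_def [symmetric],
            auto simp: axis_def\<close>)
    next
      case 2
      show ?thesis
        by (rule reduce' [of "y + axis q 1" j])
          (use 2 h q pq c w_pos [of 0 q] in \<open>auto simp: t1 rvec_simps inner_add_right inner_axis h_def [symmetric],
            auto simp: axis_def\<close>)
    next
      case 3
      show ?thesis
      proof (cases "w 0 $ p \<le> w 0 $ j")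
        case True
        show ?thesis
          by (rule reduce' [of "y - axis p 1 + axis q 1" q])
            (use True 3 h p q pq c in \<open>auto simp: t1 rvec_simps inner_add_right inner_diff_right inner_axis h_def [symmetric],
              auto simp: axis_def\<close>)
      next
        case False
        show ?thesis
        proof (cases "h + w 0 $ q < w 0 $ p")
          case True
          show ?thesis
            by (rule reduce' [of "y + axis q 1" p])
              (use True h q pq c w_pos [of 0 q] in \<open>auto simp: t1 rvec_simps inner_add_right inner_axis h_def [symmetric],
                auto simp: axis_def\<close>)
        next
          case False
          show ?thesis
            by (rule reduce' [of "y - axis p 1 + axis q 1" q])
              (use False 3 h p q pq c in \<open>auto simp: t1 rvec_simps inner_add_right inner_diff_right inner_axis h_def [symmetric],
                auto simp: axis_def\<close>)
        qed
      qed
    qed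
  qed
qed

end

section \<open>Periodic letter sequences: patches of the origin exhaust the stepped surface\<close>

lemma tfwd_scaleR: "tfwd i (c *\<^sub>R x) = c *\<^sub>R tfwd i x"
  by (simp add: tfwd_def vec_eq_iff algebra_simps)

lemma fold_tfwd_pos:
  assumes "\<And>k. 0 < (x :: real ^ 3) $ k"
  shows "0 < fold tfwd js x $ k"
  using assms
proof (induction js arbitrary: x)
  case (Cons i js)
  have "0 < tfwd i x $ k" for k
    using Cons.prems by (simp add: tfwd_def add_pos_pos)
  then show ?case by (simp add: Cons.IH)
qed simp

lemma funpow_fold_dual_step_mono:
  "F \<subseteq> G \<Longrightarrow> (fold dual_step js ^^ n) F \<subseteq> (fold dual_step js ^^ n) G"
  by (induction n) (simp_all add: fold_dual_step_mono)

text \<open>Height 0 is below \<open>w n $ a n\<close>, so the shift is 0 from then on.\<close>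

lemma (in directive) orbit_zero_persists:
  assumes "f \<in> stepped_faces (w 0)" and "fst (orbit f m) = 0" and "m \<le> n"
  shows "fst (orbit f n) = 0"
  using \<open>m \<le> n\<close>
proof (induction n rule: dec_induct)
  case (step n)
  obtain j where "orbit f n = (0, j)"
    using step.IH by (metis prod.collapse)
  then show ?case
    using w_pos [of n "a n"]
    by (simp add: pre_face_def pre_shift_def rvec_simps fwd_def vec_eq_iff)
qed (use assms in simp)

context
  fixes js :: "3 list" and v :: "real ^ 3" and \<beta> :: real
  assumes js: "set js = UNIV" and v_pos: "\<And>k. 0 < v $ k"
    and v_eigen: "fold tfwd js v = \<beta> *\<^sub>R v"
begin

text \<open>The dual step applied last is undone first, so the letter sequence is \<open>js\<close>
  read backwards and repeated. After \<open>n\<close> blocks the normal is \<open>v\<close> divided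
  by \<open>\<beta> ^ n\<close>, which has the same stepped surface as \<open>v\<close>;
  \<open>g n\<close> is the face reached there.\<close>

lemma stepped_faces_orbit:
  assumes "f \<in> stepped_faces v"
  shows "\<exists>g. (\<forall>n. g n \<in> stepped_faces v \<and> f \<in> (fold dual_step js ^^ n) {g n}) \<and> (\<exists>n. fst (g n) = 0)"
proof -
  define p where "p = length js"
  have p: "0 < p" using js by (auto simp: p_def)
  have \<beta>: "0 < \<beta>"
    using fold_tfwd_pos [of v js 1] v_pos v_pos [of 1] by (simp add: v_eigen zero_less_mult_iff)
  define a where "a n = rev js ! (n mod p)" for n
  \<comment> \<open>\<open>take (p - n mod p) js\<close> are the letters of the current block still
    to be undone; the extra factor \<open>1 / \<beta>\<close> cancels the eigenvalue gained over a
    full block.\<close>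
  define w where "w n = (1 / \<beta>) ^ Suc (n div p) *\<^sub>R fold tfwd (take (p - n mod p) js) v" for n
  have w_block: "w (n * p) = (1 / \<beta>) ^ n *\<^sub>R v" for n
    using p \<beta> by (simp add: w_def p_def v_eigen)
  have a: "a (n * p + (p - Suc q)) = js ! q" if "q < p" for n q
  proof -
    have "(n * p + (p - Suc q)) mod p = p - Suc q"
      unfolding mod_mult_self3 using that by simp
    with that show ?thesis
      by (simp add: a_def rev_nth p_def)
  qed
  interpret directive a w
  proof
    fix n k
    show "0 < w n $ k"
      using fold_tfwd_pos [of v] v_pos \<beta> by (simp add: w_def)
  next
    fix n
    define r where "r = n mod p"
    have r: "r < p" using p by (simp add: r_def)
    have "a n = js ! (p - Suc r)"
      using r by (simp add: a_def r_def p_def rev_nth)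
    moreover have "take (p - r) js = take (p - Suc r) js @ [js ! (p - Suc r)]"
      using r take_Suc_conv_app_nth [of "p - Suc r" js] by (simp add: p_def Suc_diff_Suc)
    ultimately have "w n = (1 / \<beta>) ^ Suc (n div p) *\<^sub>R tfwd (a n) (fold tfwd (take (p - Suc r) js) v)"
      by (simp add: w_def flip: r_def)
    moreover have "w (Suc n) = (1 / \<beta>) ^ Suc (n div p) *\<^sub>R fold tfwd (take (p - Suc r) js) v"
    proof (cases "Suc r = p")
      case True
      then show ?thesis
        using \<beta> take_all [of js p] by (simp add: w_def mod_Suc div_Suc r_def [symmetric] v_eigen p_def [symmetric])
    next
      case False
      then show ?thesis
        using \<beta> by (simp add: w_def mod_Suc div_Suc r_def [symmetric])
    qed
    ultimately show "w n = tfwd (a n) (w (Suc n))"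
      by (simp add: tfwd_scaleR)
  next
    fix n k
    obtain q where q: "q < p" "js ! q = k"
      using js by (metis UNIV_I in_set_conv_nth p_def)
    have "n * p + (p - Suc q) \<ge> n"
      using p by (simp add: trans_le_add1)
    moreover have "a (n * p + (p - Suc q)) = k"
      using a q by simp
    ultimately show "\<exists>m\<ge>n. a m = k" by blast
  qed
  have w0: "w 0 = v" using w_block [of 0] by simp
  with assms have f: "f \<in> stepped_faces (w 0)" by simp
  \<comment> \<open>\<open>k\<close> is the number of letters left in block \<open>m\<close>, so
    \<open>k = p\<close> is a whole block.\<close>
  have part: "k \<le> p \<Longrightarrow> orbit f (m * p + (p - k)) \<in> fold dual_step (take k js) {orbit f (m * p + p)}" for m k
  proof (induction k)
    case (Suc k)
    define n where "n = m * p + (p - Suc k)"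
    have n: "Suc n = m * p + (p - k)" using Suc.prems unfolding n_def by linarith
    have "a n = js ! k"
      using Suc.prems a by (simp add: n_def)
    then have "orbit f n \<in> dual_step (js ! k) {orbit f (Suc n)}"
      using mem_dual_step_pre_face [of "orbit f n"] by simp
    also have "\<dots> \<subseteq> dual_step (js ! k) (fold dual_step (take k js) {orbit f (m * p + p)})"
      using Suc n by (intro dual_step_mono) simp
    also have "\<dots> = fold dual_step (take (Suc k) js) {orbit f (m * p + p)}"
      using Suc.prems by (simp add: p_def take_Suc_conv_app_nth)
    finally show ?case by (simp add: n_def)
  qed simp
  have block: "orbit f (m * p) \<in> fold dual_step js {orbit f (Suc m * p)}" for m
    using part [of p m] by (simp add: p_def add.commute)
  have "f \<in> (fold dual_step js ^^ n) {orbit f (n * p)}" for n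
  proof (induction n)
    case (Suc n)
    have "{orbit f (n * p)} \<subseteq> fold dual_step js {orbit f (Suc n * p)}"
      using block [of n] by simp
    from funpow_fold_dual_step_mono [OF this, of n js] show ?case
      using Suc by (auto simp: funpow_swap1)
  qed simp
  moreover have "orbit f (n * p) \<in> stepped_faces v" for n
    using orbit_stepped [OF f, of "n * p"] \<beta>
    by (auto simp: w_block stepped_faces_def zero_le_mult_iff zero_le_power_eq divide_simps split: prod.splits)
  moreover obtain m where "fst (orbit f m) = 0"
    using orbit_reaches_zero [OF f] by blast
  \<comment> \<open>The base point may first vanish inside a block; it is still 0 at the later block
    boundary \<open>m * p\<close>.\<close>
  then have "fst (orbit f (m * p)) = 0"
    using orbit_zero_persists [OF f, of m "m * p"] p by simp
  ultimately show ?thesis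
    by (intro exI [of _ "\<lambda>n. orbit f (n * p)"]) blast
qed

lemma stepped_faces_preimage:
  assumes "f \<in> stepped_faces v"
  obtains g where "g \<in> stepped_faces v" "f \<in> (fold dual_step js ^^ n) {g}"
  using stepped_faces_orbit [OF assms] by blast

lemma stepped_faces_generated:
  assumes "f \<in> stepped_faces v"
  obtains n where "f \<in> (fold dual_step js ^^ n) initial_faces"
proof -
  obtain g n where "f \<in> (fold dual_step js ^^ n) {g}" "fst g = 0"
    using stepped_faces_orbit [OF assms] by blast
  moreover from this(2) have "{g} \<subseteq> initial_faces"
    by (cases g) (simp add: initial_faces_eq)
  ultimately show thesis
    using that funpow_fold_dual_step_mono by blast
qed

end

text \<open>Under \<open>dual_step i\<close> the face \<open>(0, i)\<close> alone already yields all
  three faces at the origin.\<close>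

lemma initial_faces_subset: "initial_faces \<subseteq> (fold dual_step js ^^ n) initial_faces"
proof -
  have "initial_faces \<subseteq> dual_step i initial_faces" for i
    by (auto simp: initial_faces_eq dual_step_def)
  then have 1: "initial_faces \<subseteq> fold dual_step js initial_faces"
    by (induction js) (simp, metis dual_step_mono fold_dual_step_mono fold_simps(2) subset_trans)
  show ?thesis
    by (induction n) (use 1 fold_dual_step_mono in \<open>auto, blast\<close>)
qed

lemma funpow_initial_mono:
  assumes "m \<le> n"
  shows "(fold dual_step js ^^ m) initial_faces \<subseteq> (fold dual_step js ^^ n) initial_faces"
proof -
  obtain d where "n = m + d" using assms le_Suc_ex by blast
  then show ?thesis
    by (simp add: funpow_add funpow_fold_dual_step_mono initial_faces_subset)
qed

section \<open>Contraction\<close>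

text \<open>The oscillation of the coordinates; it vanishes on constant vectors and is a norm on the
  plane orthogonal to a positive vector.\<close>

definition spread :: "real ^ 3 \<Rightarrow> real" where
  "spread f = max (max \<bar>f $ 1 - f $ 2\<bar> \<bar>f $ 2 - f $ 3\<bar>) \<bar>f $ 1 - f $ 3\<bar>"

lemma spread_le_iff: "spread f \<le> c \<longleftrightarrow> (\<forall>a b. \<bar>f $ a - f $ b\<bar> \<le> c)"
proof
  assume le: "spread f \<le> c"
  show "\<forall>a b. \<bar>f $ a - f $ b\<bar> \<le> c"
    using le abs_ge_zero [of "f $ 1 - f $ 2"] unfolding spread_def
    by (simp add: forall_3 abs_minus_commute) linarith
qed (simp add: spread_def)

lemma spread_less_iff: "spread f < c \<longleftrightarrow> (\<forall>a b. \<bar>f $ a - f $ b\<bar> < c)"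
proof
  assume le: "spread f < c"
  show "\<forall>a b. \<bar>f $ a - f $ b\<bar> < c"
    using le abs_ge_zero [of "f $ 1 - f $ 2"] unfolding spread_def
    by (simp add: forall_3 abs_minus_commute) linarith
qed (simp add: spread_def)

lemma diff_le_spread: "\<bar>f $ a - f $ b\<bar> \<le> spread f"
  using spread_le_iff by blast

lemma spread_scaleR: "spread (c *\<^sub>R f) = \<bar>c\<bar> * spread f"
  by (simp add: spread_def max_mult_distrib_left abs_mult flip: right_diff_distrib)

text \<open>A nonzero vector orthogonal to a positive one has coordinates of both signs, so 0 lies
  strictly between its extreme coordinates.\<close>

lemma component_less_spread:
  assumes u: "\<And>k. 0 < u $ k" and fu: "f \<bullet> u = 0" and "f \<noteq> 0"
  shows "\<bar>f $ k\<bar> < spread f"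
proof -
  have ex: "\<exists>l. g $ l < 0" if gu: "g \<bullet> u = 0" and "g \<noteq> 0" for g
  proof (rule ccontr)
    assume "\<not> ?thesis"
    then have nn: "0 \<le> g $ l * u $ l" for l
      using u [of l] by (simp add: not_less)
    have "g $ l * u $ l = 0" for l
      using gu nn [of 1] nn [of 2] nn [of 3] unfolding inner_vec3
      by (cases l rule: cases_3; hypsubst; linarith)
    then have "g $ l = 0" for l
      using u [of l] by (metis less_irrefl mult_eq_0_iff)
    with \<open>g \<noteq> 0\<close> show False by (simp add: vec_eq_iff)
  qed
  obtain l where l: "f $ l < 0" using ex [OF fu] \<open>f \<noteq> 0\<close> by blast
  obtain m where m: "0 < f $ m" using ex [of "- f"] fu \<open>f \<noteq> 0\<close> by auto
  show ?thesis
    using diff_le_spread [of f k l] diff_le_spread [of f k m] l m by linarith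
qed

lemma component_le_spread:
  assumes "\<And>k. 0 < u $ k" and "f \<bullet> u = 0"
  shows "\<bar>f $ k\<bar> \<le> spread f"
  using component_less_spread [OF assms, of k] by (cases "f = 0") (auto simp: spread_def)

lemma tfwd_eq_0: "tfwd i f = 0 \<Longrightarrow> f = (0 :: real ^ 3)"
  by (cases i rule: cases_3) (auto simp: vec_eq_iff tfwd_def forall_3)

text \<open>Coordinate \<open>i\<close> is neither largest nor smallest; in this state a step with
  any other letter decreases the spread.\<close>

definition strictly_between :: "3 \<Rightarrow> real ^ 3 \<Rightarrow> bool" where
  "strictly_between i f \<longleftrightarrow> (\<forall>j. \<bar>f $ i - f $ j\<bar> < spread f)"

text \<open>\<open>tfwd i\<close> keeps the difference of the other two coordinates, while their
  differences to coordinate \<open>i\<close> become old coordinates, which are below the spread. So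
  the old spread can survive only between the other two.\<close>

lemma spread_tfwd_cases:
  assumes "\<And>k. 0 < u $ k" and "f \<bullet> u = 0" and "f \<noteq> 0"
  shows "spread (tfwd i f) < spread f \<or> spread (tfwd i f) = spread f \<and> strictly_between i (tfwd i f)"
proof -
  note less = component_less_spread [OF assms]
  have "strictly_between i (tfwd i f)" if "spread (tfwd i f) = spread f"
    unfolding strictly_between_def
  proof
    fix l
    show "\<bar>tfwd i f $ i - tfwd i f $ l\<bar> < spread (tfwd i f)"
      unfolding that using less [of l] less [of i] by (auto simp: tfwd_def)
  qed
  moreover have "spread (tfwd i f) \<le> spread f"
    unfolding spread_le_iff
  proof (intro allI)
    fix a b
    show "\<bar>tfwd i f $ a - tfwd i f $ b\<bar> \<le> spread f"
      using less [of a] less [of b] diff_le_spread [of f a b] by (auto simp: tfwd_def)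
  qed
  ultimately show ?thesis by linarith
qed

text \<open>Of the three new differences two are old coordinates and the third is an old difference
  involving \<open>i\<close>; all are below the spread.\<close>

lemma spread_tfwd_less:
  assumes "\<And>k. 0 < u $ k" and "f \<bullet> u = 0" and "f \<noteq> 0" and "strictly_between i f" and "l \<noteq> i"
  shows "spread (tfwd l f) < spread f"
proof -
  note less = component_less_spread [OF assms(1-3)]
  have between: "\<bar>f $ i - f $ a\<bar> < spread f" for a
    using assms(4) by (simp add: strictly_between_def)
  obtain k where k: "k \<noteq> l" "k \<noteq> i" using ex_other_3 by blast
  show ?thesis
    unfolding spread_less_iff
  proof (intro allI)
    fix a b
    show "\<bar>tfwd l f $ a - tfwd l f $ b\<bar> < spread f"
      using third_3 [OF assms(5) k, of a] third_3 [OF assms(5) k, of b] less [of a] less [of b]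
        between [of a] between [of b] by (auto simp: tfwd_def abs_minus_commute)
  qed
qed

lemma foldr_fwd_pos:
  assumes "\<And>k. 0 < (u :: real ^ 3) $ k"
  shows "0 < foldr fwd js u $ k"
  using assms
proof (induction js arbitrary: k)
  case (Cons i js)
  then show ?case by (simp add: fwd_def add_pos_pos)
qed simp

lemma inner_foldr_fwd: "f \<bullet> foldr fwd js u = fold tfwd js f \<bullet> (u :: real ^ 3)"
  by (induction js arbitrary: f) (simp_all add: inner_fwd)

text \<open>Orthogonality is required to \<open>foldr fwd js u\<close> because it is inherited:
  \<open>inner_fwd\<close> moves the first letter over to \<open>f\<close>.\<close>

lemma spread_fold_tfwd_le:
  assumes u: "\<And>k. 0 < u $ k" and "f \<bullet> foldr fwd js u = 0"
  shows "spread (fold tfwd js f) \<le> spread f"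
  using assms(2)
proof (induction js arbitrary: f)
  case (Cons i js)
  have le: "spread (tfwd i f) \<le> spread f"
  proof (cases "f = 0")
    case True
    then show ?thesis by (simp add: tfwd_def spread_def)
  next
    case False
    from spread_tfwd_cases [OF foldr_fwd_pos [OF u] Cons.prems False, of i] show ?thesis by auto
  qed
  have "tfwd i f \<bullet> foldr fwd js u = 0"
    using Cons.prems by (simp add: inner_fwd)
  from Cons.IH [OF this] le show ?case by simp
qed simp

text \<open>A repetition of \<open>i\<close> decreases the spread or leaves \<open>i\<close>
  strictly between; the first other letter then decreases it.\<close>

lemma spread_fold_tfwd_less_between:
  assumes u: "\<And>k. 0 < u $ k" and "f \<bullet> foldr fwd js u = 0" "f \<noteq> 0" "strictly_between i f" "\<not> set js \<subseteq> {i}"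
  shows "spread (fold tfwd js f) < spread f"
  using assms(2-)
proof (induction js arbitrary: f)
  case (Cons l js)
  have orth: "tfwd l f \<bullet> foldr fwd js u = 0"
    using Cons.prems(1) by (simp add: inner_fwd)
  note le = spread_fold_tfwd_le [OF u orth]
  show ?case
  proof (cases "l = i")
    case False
    have "spread (tfwd l f) < spread f"
      using spread_tfwd_less [OF foldr_fwd_pos [OF u] Cons.prems(1-3) False] .
    with le show ?thesis by simp
  next
    case True
    have nz: "tfwd l f \<noteq> 0" using tfwd_eq_0 Cons.prems(2) by blast
    from spread_tfwd_cases [OF foldr_fwd_pos [OF u] Cons.prems(1,2), of l] show ?thesis
    proof
      assume "spread (tfwd l f) < spread f"
      with le show ?thesis by simp
    next
      assume "spread (tfwd l f) = spread f \<and> strictly_between l (tfwd l f)"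
      then show ?thesis
        using Cons.IH [OF orth nz] True Cons.prems(4) by simp
    qed
  qed
qed simp

lemma spread_fold_tfwd_less:
  assumes js: "set js = UNIV" and u: "\<And>k. 0 < u $ k" and f: "f \<bullet> foldr fwd js u = 0" "f \<noteq> 0"
  shows "spread (fold tfwd js f) < spread f"
proof -
  obtain i js' where js': "js = i # js'" using js by (cases js) auto
  have "\<not> set js' \<subseteq> {i}"
  proof
    assume "set js' \<subseteq> {i}"
    then have "UNIV = {i}" using js js' by auto
    then show False using ex_other_3 [of i i] by auto
  qed
  moreover have orth: "tfwd i f \<bullet> foldr fwd js' u = 0"
    using f(1) by (simp add: js' inner_fwd)
  moreover have nz: "tfwd i f \<noteq> 0" using tfwd_eq_0 f(2) by blast
  ultimately show ?thesis
    using spread_tfwd_cases [OF foldr_fwd_pos [OF u] f, of i] spread_fold_tfwd_le [OF u orth]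
      spread_fold_tfwd_less_between [OF u orth nz, of i] by (force simp: js')
qed

section \<open>Uniform contraction by compactness and duality\<close>

lemma linear_tfwd: "linear (tfwd i :: real ^ 3 \<Rightarrow> _)"
  by (rule linearI) (simp_all add: tfwd_def vec_eq_iff algebra_simps)

lemma linear_fold_tfwd: "linear (fold tfwd js :: real ^ 3 \<Rightarrow> _)"
proof (induction js)
  case (Cons i js)
  then show ?case
    using linear_compose [OF linear_tfwd] by (simp add: comp_def)
qed (simp add: linearI)

text \<open>The ratio of new to old spread is homogeneous of degree 0, continuous and below 1 on the
  compact unit circle of the plane; its maximum there is the factor \<open>\<rho>\<close>.\<close>

lemma spread_fold_tfwd_contraction:
  fixes u :: "real ^ 3"
  assumes js: "set js = UNIV" and u: "\<And>k. 0 < u $ k" and eigen: "foldr fwd js u = \<beta> *\<^sub>R u"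
  obtains \<rho> where "0 \<le> \<rho>" "\<rho> < 1" "\<And>f. f \<bullet> u = 0 \<Longrightarrow> spread (fold tfwd js f) \<le> \<rho> * spread f"
proof -
  define S where "S = {f. f \<bullet> u = 0} \<inter> sphere 0 1"
  have orth: "f \<bullet> foldr fwd js u = 0" if "f \<bullet> u = 0" for f
    using that by (simp add: eigen)
  have pos: "0 < spread f" if "f \<in> S" for f
  proof -
    have "f \<bullet> u = 0" "f \<noteq> 0" using that by (auto simp: S_def)
    from component_less_spread [OF u this, of 1] show ?thesis by simp
  qed
  have "compact S"
    unfolding S_def by (intro closed_Int_compact closed_hyperplane [of u, unfolded inner_commute [of u]] compact_sphere)
  moreover have "continuous_on S (\<lambda>f. spread (fold tfwd js f) / spread f)"
  proof -
    have c: "continuous_on T spread" for T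
      unfolding spread_def by (intro continuous_intros)
    have "continuous_on S (fold tfwd js)"
      by (rule linear_continuous_on) (use linear_fold_tfwd linear_conv_bounded_linear in blast)
    then have "continuous_on S (\<lambda>f. spread (fold tfwd js f))"
      by (rule continuous_on_compose2 [OF c]) auto
    then show ?thesis
      using pos by (intro continuous_on_divide c) (auto simp: less_imp_neq [symmetric])
  qed
  ultimately have ex: "S \<noteq> {} \<Longrightarrow> \<exists>g\<in>S. \<forall>f\<in>S. spread (fold tfwd js f) / spread f \<le> spread (fold tfwd js g) / spread g"
    by (rule_tac continuous_attains_sup)
  have "\<exists>\<rho>. 0 \<le> \<rho> \<and> \<rho> < 1 \<and> (\<forall>f\<in>S. spread (fold tfwd js f) \<le> \<rho> * spread f)"
  proof (cases "S = {}")
    case True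
    then show ?thesis by (intro exI [of _ 0]) auto
  next
    case False
    from ex [OF this] obtain g where g: "g \<in> S"
      "\<And>f. f \<in> S \<Longrightarrow> spread (fold tfwd js f) / spread f \<le> spread (fold tfwd js g) / spread g"
      by blast
    have "spread (fold tfwd js g) < spread g"
      using g(1) orth by (intro spread_fold_tfwd_less [OF js u]) (auto simp: S_def)
    moreover have "0 \<le> spread (fold tfwd js g)" by (simp add: spread_def)
    ultimately show ?thesis
      using g pos by (intro exI [of _ "spread (fold tfwd js g) / spread g"])
        (auto simp: pos_divide_le_eq divide_le_eq less_imp_le)
  qed
  then obtain \<rho> where \<rho>: "0 \<le> \<rho>" "\<rho> < 1" "\<And>f. f \<in> S \<Longrightarrow> spread (fold tfwd js f) \<le> \<rho> * spread f"
    by blast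
  show thesis
  proof (rule that [OF \<rho>(1,2)])
    fix f :: "real ^ 3" assume f: "f \<bullet> u = 0"
    show "spread (fold tfwd js f) \<le> \<rho> * spread f"
    proof (cases "f = 0")
      case True
      then show ?thesis
        using linear_0 [OF linear_fold_tfwd] by (simp add: spread_def)
    next
      case False
      define g where "g = (1 / norm f) *\<^sub>R f"
      have "g \<in> S" and fg: "f = norm f *\<^sub>R g" using False f by (simp_all add: S_def g_def)
      have "spread (fold tfwd js f) = norm f * spread (fold tfwd js g)"
        by (subst fg) (simp add: linear_cmul [OF linear_fold_tfwd] spread_scaleR)
      also have "\<dots> \<le> norm f * (\<rho> * spread g)"
        using \<rho>(3) [OF \<open>g \<in> S\<close>] by (intro mult_left_mono) auto
      also have "\<dots> = \<rho> * spread f"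
        using arg_cong [OF fg, of spread] by (simp add: spread_scaleR)
      finally show ?thesis .
    qed
  qed
qed

text \<open>Coordinates of the iterates are pairings, and the adjoint of \<open>foldr fwd js\<close>
  is \<open>fold tfwd js\<close>, which contracts the plane orthogonal to \<open>u\<close>.\<close>

lemma foldr_fwd_contraction:
  fixes u v :: "real ^ 3"
  assumes js: "set js = UNIV" and u: "\<And>k. 0 < u $ k" and v: "\<And>k. 0 < v $ k"
    and u_eigen: "foldr fwd js u = \<beta> *\<^sub>R u" and v_eigen: "fold tfwd js v = \<beta> *\<^sub>R v"
  obtains C \<rho> where "0 \<le> C" "0 \<le> \<rho>" "\<rho> < 1"
    "\<And>n x. v \<bullet> x = 0 \<Longrightarrow> norm ((foldr fwd js ^^ n) x) \<le> C * \<rho> ^ n * norm x"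
proof -
  obtain \<rho> where \<rho>: "0 \<le> \<rho>" "\<rho> < 1"
    and le: "\<And>f. f \<bullet> u = 0 \<Longrightarrow> spread (fold tfwd js f) \<le> \<rho> * spread f"
    using spread_fold_tfwd_contraction [OF js u u_eigen] by blast
  have pow: "(fold tfwd js ^^ n) f \<bullet> u = 0 \<and> spread ((fold tfwd js ^^ n) f) \<le> \<rho> ^ n * spread f"
    if "f \<bullet> u = 0" for f n
  proof (induction n)
    case (Suc n)
    let ?g = "(fold tfwd js ^^ n) f"
    have "spread (fold tfwd js ?g) \<le> \<rho> * spread ?g" using Suc le by blast
    also have "\<dots> \<le> \<rho> * (\<rho> ^ n * spread f)" using Suc \<rho> by (intro mult_left_mono) auto
    finally show ?case
      using Suc inner_foldr_fwd [of ?g js u] by (simp add: u_eigen mult.assoc)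
  qed (use that in simp)
  have dual: "f \<bullet> (foldr fwd js ^^ n) x = (fold tfwd js ^^ n) f \<bullet> x" for f x :: "real ^ 3" and n
  proof (induction n arbitrary: f)
    case (Suc n)
    have "f \<bullet> (foldr fwd js ^^ Suc n) x = fold tfwd js f \<bullet> (foldr fwd js ^^ n) x"
      by (simp add: inner_foldr_fwd)
    also have "\<dots> = (fold tfwd js ^^ Suc n) f \<bullet> x"
      by (simp add: Suc funpow_swap1)
    finally show ?case .
  qed simp
  have vu: "v \<bullet> u > 0"
    using u v by (simp add: inner_vec3 add_pos_pos)
  \<comment> \<open>\<open>axis k 1\<close> is corrected along \<open>v\<close> to become orthogonal
    to \<open>u\<close>. The iterates of \<open>x\<close> stay orthogonal to \<open>v\<close>, so
    pairing with \<open>g k\<close> still reads off coordinate \<open>k\<close>.\<close>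
  define g where "g k = axis k 1 - (u $ k / (v \<bullet> u)) *\<^sub>R v" for k
  have gu: "g k \<bullet> u = 0" for k
    using vu by (simp add: g_def inner_diff_left inner_axis')
  have v_orth: "v \<bullet> (foldr fwd js ^^ n) x = 0" if "v \<bullet> x = 0" for x n
  proof -
    have "(fold tfwd js ^^ n) v = \<beta> ^ n *\<^sub>R v"
      by (induction n) (simp_all add: linear_cmul [OF linear_fold_tfwd] v_eigen)
    then show ?thesis by (simp add: dual that)
  qed
  have norm_le: "norm f \<le> 3 * spread f" if "f \<bullet> u = 0" for f
    using norm_le_l1_cart [of f] component_le_spread [OF u that, of 1]
      component_le_spread [OF u that, of 2] component_le_spread [OF u that, of 3]
    by (simp add: sum_3)
  have comp: "\<bar>(foldr fwd js ^^ n) x $ k\<bar> \<le> 3 * spread (g k) * \<rho> ^ n * norm x" if x: "v \<bullet> x = 0" for n x k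
  proof -
    have "(foldr fwd js ^^ n) x $ k = g k \<bullet> (foldr fwd js ^^ n) x"
      using v_orth [OF x] by (simp add: g_def inner_diff_left inner_axis')
    also have "\<bar>\<dots>\<bar> \<le> norm ((fold tfwd js ^^ n) (g k)) * norm x"
      unfolding dual by (rule Cauchy_Schwarz_ineq2)
    also have "\<dots> \<le> 3 * (\<rho> ^ n * spread (g k)) * norm x"
      using pow [OF gu, of n k] norm_le [of "(fold tfwd js ^^ n) (g k)"]
      by (intro mult_right_mono) auto
    finally show ?thesis by (simp add: mult_ac)
  qed
  show thesis
  proof (rule that [OF _ \<rho>, of "3 * spread (g 1) + 3 * spread (g 2) + 3 * spread (g 3)"])
    show "0 \<le> 3 * spread (g 1) + 3 * spread (g 2) + 3 * spread (g 3)"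
      by (simp add: spread_def)
  next
    fix n x assume x: "v \<bullet> x = 0"
    show "norm ((foldr fwd js ^^ n) x) \<le> (3 * spread (g 1) + 3 * spread (g 2) + 3 * spread (g 3)) * \<rho> ^ n * norm x"
      using norm_le_l1_cart [of "(foldr fwd js ^^ n) x"] comp [OF x, of n 1] comp [OF x, of n 2] comp [OF x, of n 3]
      by (simp add: sum_3 algebra_simps)
  qed
qed

section \<open>Hausdorff limits\<close>

lemma infdist_lessE:
  assumes "infdist x A < e" "A \<noteq> {}"
  obtains a where "a \<in> A" "dist x a < e"
  using assms that cINF_less_iff [OF \<open>A \<noteq> {}\<close>, of "dist x" e] bdd_belowI2 [of A 0 "dist x"]
  by (auto simp: infdist_notempty)

lemma infdist_le_hausdorff_distance:
  assumes "bounded A" "bounded B" "A \<noteq> {}" "B \<noteq> {}"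
  shows "a \<in> A \<Longrightarrow> infdist a B \<le> hausdorff_distance A B"
    and "b \<in> B \<Longrightarrow> infdist b A \<le> hausdorff_distance A B"
proof -
  have bdd: "bdd_above ((\<lambda>a. infdist a B) ` A)" if "bounded A" "B \<noteq> {}" for A B :: "'a set"
  proof -
    obtain b where b: "b \<in> B" using \<open>B \<noteq> {}\<close> by blast
    obtain e where e: "\<And>a. a \<in> A \<Longrightarrow> dist b a \<le> e"
      using \<open>bounded A\<close> bounded_any_center [of A b] by auto
    have "infdist a B \<le> e" if "a \<in> A" for a
      using infdist_le [OF b, of a] e [OF that] by (simp add: dist_commute)
    then show ?thesis by (intro bdd_aboveI2 [of _ _ e])
  qed
  show "a \<in> A \<Longrightarrow> infdist a B \<le> hausdorff_distance A B"
    unfolding hausdorff_distance_def using cSUP_upper [OF _ bdd [OF assms(1,4)], of a]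
    by (simp add: max.coboundedI1)
  show "b \<in> B \<Longrightarrow> infdist b A \<le> hausdorff_distance A B"
    unfolding hausdorff_distance_def using cSUP_upper [OF _ bdd [OF assms(2,3)], of b]
    by (simp add: max.coboundedI2)
qed

lemma hausdorff_distance_le:
  assumes "A \<noteq> {}" "B \<noteq> {}" "\<And>a. a \<in> A \<Longrightarrow> infdist a B \<le> e" "\<And>b. b \<in> B \<Longrightarrow> infdist b A \<le> e"
  shows "hausdorff_distance A B \<le> e"
  using assms unfolding hausdorff_distance_def by (auto intro!: cSUP_least)

lemma hausdorff_distance_nonneg:
  assumes "bounded A" "bounded B" "A \<noteq> {}" "B \<noteq> {}"
  shows "0 \<le> hausdorff_distance A B"
  using infdist_le_hausdorff_distance(1) [OF assms] infdist_nonneg \<open>A \<noteq> {}\<close>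
  by (metis ex_in_conv order_trans)

lemma hausdorff_limit_unique:
  fixes D :: "nat \<Rightarrow> 'a::metric_space set"
  assumes D: "\<And>n. bounded (D n)" "\<And>n. D n \<noteq> {}"
    and R: "compact R" "R \<noteq> {}" "(\<lambda>n. hausdorff_distance (D n) R) \<longlonglongrightarrow> 0"
    and S: "compact S" "S \<noteq> {}" "(\<lambda>n. hausdorff_distance (D n) S) \<longlonglongrightarrow> 0"
  shows "R = S"
proof -
  have sub: "R \<subseteq> S"
    if R: "compact R" "R \<noteq> {}" "(\<lambda>n. hausdorff_distance (D n) R) \<longlonglongrightarrow> 0"
      and S: "compact S" "S \<noteq> {}" "(\<lambda>n. hausdorff_distance (D n) S) \<longlonglongrightarrow> 0" for R S
  proof
    fix r assume r: "r \<in> R"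
    have "infdist r S \<le> e" if "0 < e" for e
    proof -
      have "\<forall>\<^sub>F n in sequentially. hausdorff_distance (D n) R < e / 2 \<and> hausdorff_distance (D n) S < e / 2"
        using order_tendstoD(2) [OF R(3), of "e / 2"] order_tendstoD(2) [OF S(3), of "e / 2"] \<open>0 < e\<close>
        by (simp add: eventually_conj)
      then obtain n where n: "hausdorff_distance (D n) R < e / 2" "hausdorff_distance (D n) S < e / 2"
        using eventually_happens' [OF sequentially_bot] by blast
      have "infdist r (D n) < e / 2"
        using infdist_le_hausdorff_distance(2) [OF D(1) compact_imp_bounded [OF R(1)] D(2) R(2) r, of n] n
        by linarith
      then obtain d where d: "d \<in> D n" "dist r d < e / 2"
        using infdist_lessE D(2) by blast
      have "infdist d S < e / 2"
        using infdist_le_hausdorff_distance(1) [OF D(1) compact_imp_bounded [OF S(1)] D(2) S(2) d(1)] n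
        by linarith
      then show ?thesis
        using infdist_triangle [of r S d] d(2) by linarith
    qed
    then have "infdist r S \<le> 0"
      by (rule field_le_epsilon) auto
    then have "infdist r S = 0"
      using infdist_nonneg [of r S] by linarith
    then show "r \<in> S"
      using in_closed_iff_infdist_zero [OF compact_imp_closed [OF S(1)] S(2)] by blast
  qed
  show ?thesis
    using sub [OF R S] sub [OF S R] by blast
qed

text \<open>If the limit split into two parts at distance \<open>d\<close>, their
  \<open>d / 2\<close> neighbourhoods would separate \<open>D n\<close> once the Hausdorff distance
  is below \<open>d / 2\<close>.\<close>

lemma connected_hausdorff_limit:
  fixes D :: "nat \<Rightarrow> 'a::heine_borel set"
  assumes D: "\<And>n. bounded (D n)" "\<And>n. D n \<noteq> {}" "\<And>n. connected (D n)"
    and R: "compact R" "R \<noteq> {}" "(\<lambda>n. hausdorff_distance (D n) R) \<longlonglongrightarrow> 0"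
  shows "connected R"
proof (rule ccontr)
  assume "\<not> connected R"
  then obtain A B where AB: "closed A" "closed B" "A \<noteq> {}" "B \<noteq> {}" "A \<union> B = R" "A \<inter> B = {}"
    using connected_closed_set [OF compact_imp_closed [OF R(1)]] by auto
  have "compact A"
    using AB R(1) by (metis compact_Int_closed Un_Int_eq(1))
  then obtain d where d: "0 < d" "\<And>x y. x \<in> A \<Longrightarrow> y \<in> B \<Longrightarrow> d \<le> dist x y"
    using separate_compact_closed [OF _ AB(2,6)] by blast
  obtain n where n: "hausdorff_distance (D n) R < d / 2"
    using eventually_happens' [OF sequentially_bot order_tendstoD(2) [OF R(3), of "d / 2"]] d by auto
  note near = infdist_le_hausdorff_distance [OF D(1) compact_imp_bounded [OF R(1)] D(2) R(2), of _ n]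
  define U where "U C = {x. infdist x C < d / 2}" for C :: "'a set"
  have openU: "open (U C)" for C
    unfolding U_def by (intro open_Collect_less continuous_intros)
  have meets: "U C \<inter> D n \<noteq> {}" if C: "C \<subseteq> R" "C \<noteq> {}" for C
  proof -
    obtain x where x: "x \<in> C" using C(2) by blast
    then have "infdist x (D n) < d / 2" using near(2) [of x] n C(1) by fastforce
    then obtain y where "y \<in> D n" "dist x y < d / 2" using infdist_lessE D(2) by blast
    moreover have "infdist y C \<le> dist y x" using x by (rule infdist_le)
    ultimately have "y \<in> U C \<inter> D n" by (simp add: U_def dist_commute)
    then show ?thesis by blast
  qed
  have "D n \<subseteq> U A \<union> U B"
  proof
    fix x assume "x \<in> D n"
    then have "infdist x R < d / 2" using near(1) [of x] n by linarith
    then obtain r where r: "r \<in> R" "dist x r < d / 2" using infdist_lessE R(2) by blast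
    then show "x \<in> U A \<union> U B"
      using AB(5) infdist_le [of r A x] infdist_le [of r B x] by (auto simp: U_def)
  qed
  moreover have "U A \<inter> U B \<inter> D n = {}"
  proof -
    have False if x: "x \<in> U A" "x \<in> U B" for x
    proof -
      obtain p q where "p \<in> A" "dist x p < d / 2" "q \<in> B" "dist x q < d / 2"
        using x infdist_lessE AB(3,4) unfolding U_def by (metis mem_Collect_eq)
      then show False
        using d(2) [of p q] dist_triangle3 [of p q x] by linarith
    qed
    then show ?thesis by blast
  qed
  ultimately have "U A \<inter> D n = {} \<or> U B \<inter> D n = {}"
    by (intro connectedD [OF D(3) openU openU])
  then show False
    using meets [of A] meets [of B] AB by blast
qed

text \<open>Points can be followed in both directions with errors whose tail from \<open>n\<close>
  on sums to \<open>K / (1 - \<rho>) * \<rho> ^ n\<close>. The limit set consists of the points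
  within this tail of every \<open>D n\<close>.\<close>

lemma geometric_hausdorff_limit:
  fixes D :: "nat \<Rightarrow> 'a::{heine_borel, complete_space} set"
  assumes D0: "bounded (D 0)" and ne: "\<And>n. D n \<noteq> {}" and \<rho>: "0 \<le> \<rho>" "\<rho> < 1" and K: "0 \<le> K"
    and fwd: "\<And>n a. a \<in> D n \<Longrightarrow> \<exists>b\<in>D (Suc n). dist a b \<le> K * \<rho> ^ n"
    and bwd: "\<And>n b. b \<in> D (Suc n) \<Longrightarrow> \<exists>a\<in>D n. dist a b \<le> K * \<rho> ^ n"
  obtains R where "compact R" "R \<noteq> {}"
    "\<And>n a. a \<in> D n \<Longrightarrow> infdist a R \<le> K / (1 - \<rho>) * \<rho> ^ n"
    "\<And>n r. r \<in> R \<Longrightarrow> infdist r (D n) \<le> K / (1 - \<rho>) * \<rho> ^ n"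
proof -
  define L where "L = K / (1 - \<rho>)"
  have L: "0 \<le> L" using K \<rho> by (simp add: L_def)
  have KL: "K = L * (1 - \<rho>)" using \<rho> by (simp add: L_def)
  \<comment> \<open>The bound is the exact finite geometric sum, which makes the induction on
    \<open>m\<close> work.\<close>
  have trace: "\<exists>a\<in>D n. dist a b \<le> L * \<rho> ^ n * (1 - \<rho> ^ m)" if "b \<in> D (n + m)" for n m b
    using that
  proof (induction m arbitrary: b)
    case 0
    then show ?case by (intro bexI [of _ b]) auto
  next
    case (Suc m)
    then obtain c where c: "c \<in> D (n + m)" "dist c b \<le> K * \<rho> ^ (n + m)"
      using bwd [of b "n + m"] by auto
    from Suc.IH [OF c(1)] obtain a where a: "a \<in> D n" "dist a c \<le> L * \<rho> ^ n * (1 - \<rho> ^ m)" by blast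
    have "dist a b \<le> L * \<rho> ^ n * (1 - \<rho> ^ m) + K * \<rho> ^ (n + m)"
      using dist_triangle [of a b c] a c by linarith
    also have "\<dots> = L * \<rho> ^ n * (1 - \<rho> ^ Suc m)"
      by (simp add: KL power_add algebra_simps)
    finally show ?case using a by blast
  qed
  have trace': "infdist b (D n) \<le> L * \<rho> ^ n" if b: "b \<in> D (n + m)" for n m b
  proof -
    obtain a where a: "a \<in> D n" "dist a b \<le> L * \<rho> ^ n * (1 - \<rho> ^ m)" using trace [OF b] by blast
    have "L * \<rho> ^ n * (1 - \<rho> ^ m) \<le> L * \<rho> ^ n * 1"
      using L \<rho> by (intro mult_left_mono) auto
    then show ?thesis
      using infdist_le [OF a(1), of b] a(2) by (simp add: dist_commute)
  qed
  have lim0: "(\<lambda>k. L * \<rho> ^ (n + k)) \<longlonglongrightarrow> 0" for n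
  proof -
    have "(\<lambda>k. L * \<rho> ^ n * \<rho> ^ k) \<longlonglongrightarrow> L * \<rho> ^ n * 0"
      using \<rho> by (intro tendsto_intros LIMSEQ_realpow_zero)
    then show ?thesis by (simp add: power_add mult.assoc)
  qed
  define R where "R = {x. \<forall>n. infdist x (D n) \<le> L * \<rho> ^ n}"
  have approx: "\<exists>r\<in>R. dist a r \<le> L * \<rho> ^ n" if a: "a \<in> D n" for n a
  proof -
    \<comment> \<open>A chain of forward neighbours starting at \<open>a\<close>. It is Cauchy, and
      its limit is in \<open>R\<close> because late members trace back to each
      \<open>D j\<close>.\<close>
    have "\<exists>s. \<forall>k. (s k \<in> D (n + k) \<and> (k = 0 \<longrightarrow> s k = a)) \<and> dist (s k) (s (Suc k)) \<le> K * \<rho> ^ (n + k)"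
    proof (rule dependent_nat_choice)
      show "\<exists>x. x \<in> D (n + 0) \<and> (0 = (0::nat) \<longrightarrow> x = a)" using a by auto
    qed (use fwd in fastforce)
    then obtain s where s: "\<And>k. s k \<in> D (n + k)" "s 0 = a" "\<And>k. dist (s k) (s (Suc k)) \<le> K * \<rho> ^ (n + k)"
      by blast
    have "dist (s k) (s (k + m)) \<le> L * \<rho> ^ (n + k) * (1 - \<rho> ^ m)" for k m
    proof (induction m)
      case (Suc m)
      have "dist (s k) (s (k + Suc m)) \<le> L * \<rho> ^ (n + k) * (1 - \<rho> ^ m) + K * \<rho> ^ (n + (k + m))"
        using dist_triangle [of "s k" "s (k + Suc m)" "s (k + m)"] Suc s(3) [of "k + m"] by simp
      also have "\<dots> = L * \<rho> ^ (n + k) * (1 - \<rho> ^ Suc m)"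
        by (simp add: KL power_add algebra_simps)
      finally show ?case .
    qed simp
    moreover have "L * \<rho> ^ (n + k) * (1 - \<rho> ^ m) \<le> L * \<rho> ^ (n + k) * 1" for k m
      using L \<rho> by (intro mult_left_mono) auto
    ultimately have close: "dist (s k) (s (k + m)) \<le> L * \<rho> ^ (n + k)" for k m
      using order_trans by fastforce
    have "Cauchy s"
    proof (rule metric_CauchyI)
      fix e :: real assume "0 < e"
      then obtain k where k: "L * \<rho> ^ (n + k) < e / 2"
        using eventually_happens' [OF sequentially_bot order_tendstoD(2) [OF lim0, of "e / 2"]] by auto
      have "dist (s i) (s j) < e" if "i \<ge> k" "j \<ge> k" for i j
        using close [of k "i - k"] close [of k "j - k"] that k dist_triangle3 [of "s i" "s j" "s k"] by simp
      then show "\<exists>M. \<forall>m\<ge>M. \<forall>n\<ge>M. dist (s m) (s n) < e" by blast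
    qed
    then obtain r where r: "s \<longlonglongrightarrow> r"
      using Cauchy_convergent_iff convergent_def by blast
    have sr: "dist (s k) r \<le> L * \<rho> ^ (n + k)" for k
    proof (rule LIMSEQ_le_const2)
      show "(\<lambda>m. dist (s k) (s m)) \<longlonglongrightarrow> dist (s k) r"
        using r by (intro tendsto_intros)
      show "\<exists>N. \<forall>m\<ge>N. dist (s k) (s m) \<le> L * \<rho> ^ (n + k)"
        using close [of k] by (metis le_add_diff_inverse)
    qed
    have "infdist r (D j) \<le> L * \<rho> ^ j" for j
    proof (rule LIMSEQ_le_const)
      show "(\<lambda>k. L * \<rho> ^ (n + k) + L * \<rho> ^ j) \<longlonglongrightarrow> L * \<rho> ^ j"
        using tendsto_add [OF lim0 [of n] tendsto_const [of "L * \<rho> ^ j"]] by simp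
      have "infdist r (D j) \<le> L * \<rho> ^ (n + k) + L * \<rho> ^ j" if "k \<ge> j" for k
      proof -
        have "infdist (s k) (D j) \<le> L * \<rho> ^ j"
          using s(1) [of k] that by (intro trace' [of _ _ "n + k - j"]) simp
        then show ?thesis
          using infdist_triangle [of r "D j" "s k"] sr [of k] by (simp add: dist_commute)
      qed
      then show "\<exists>N. \<forall>k\<ge>N. infdist r (D j) \<le> L * \<rho> ^ (n + k) + L * \<rho> ^ j" by blast
    qed
    then have "r \<in> R" by (simp add: R_def)
    with sr [of 0] s(2) show ?thesis by auto
  qed
  have "closed R"
    unfolding R_def by (intro closed_Collect_all closed_Collect_le continuous_intros)
  moreover have "bounded R"
  proof -
    obtain x e where xe: "\<And>d. d \<in> D 0 \<Longrightarrow> dist x d \<le> e"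
      using D0 by (auto simp: bounded_def)
    have "dist x r \<le> e + (L + 1)" if "r \<in> R" for r
    proof -
      have "infdist r (D 0) < L + 1"
        using that by (auto simp: R_def dest: spec [of _ 0])
      then obtain d where "d \<in> D 0" "dist r d < L + 1"
        using infdist_lessE ne by blast
      then show ?thesis
        using xe [of d] dist_triangle [of x r d] by (simp add: dist_commute)
    qed
    then show ?thesis unfolding bounded_def by blast
  qed
  ultimately have "compact R" by (simp add: compact_eq_bounded_closed)
  moreover have "R \<noteq> {}" using approx ne [of 0] by blast
  moreover have "infdist a R \<le> L * \<rho> ^ n" if "a \<in> D n" for n a
    using approx [OF that] infdist_le order_trans by blast
  moreover have "infdist r (D n) \<le> L * \<rho> ^ n" if "r \<in> R" for n r
    using that by (simp add: R_def)
  ultimately show thesis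
    using that unfolding L_def by blast
qed

section \<open>The Rauzy fractal\<close>

lemma rvec_foldr_fwd: "rvec (foldr fwd js x) = foldr fwd js (rvec x)"
  by (induction js) (simp_all add: rvec_simps)

lemma linear_foldr_fwd: "linear (foldr fwd js :: real ^ 3 \<Rightarrow> _)"
proof (induction js)
  case (Cons i js)
  have "linear (fwd i :: real ^ 3 \<Rightarrow> _)"
    by (rule linearI) (simp_all add: fwd_def vec_eq_iff algebra_simps)
  from linear_compose [OF Cons.IH this] show ?case by (simp add: comp_def)
qed (simp add: linearI)

lemma linear_fold_bwd: "linear (fold bwd js :: real ^ 3 \<Rightarrow> _)"
proof (induction js)
  case (Cons i js)
  have "linear (bwd i :: real ^ 3 \<Rightarrow> _)"
    by (rule linearI) (simp_all add: bwd_def vec_eq_iff algebra_simps)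
  from linear_compose [OF this Cons.IH] show ?case by (simp add: comp_def)
qed (simp add: linearI)

lemma linear_funpow: "linear (f :: 'a::real_vector \<Rightarrow> 'a) \<Longrightarrow> linear (f ^^ n)"
  by (induction n) (auto simp: linearI intro: linear_compose)

lemma foldr_fwd_fold_bwd: "foldr fwd js (fold bwd js x) = x"
  by (induction js arbitrary: x) simp_all

lemma funpow_fwd_bwd: "(foldr fwd js ^^ n) ((fold bwd js ^^ n) x) = x"
proof (induction n)
  case (Suc n)
  have "(foldr fwd js ^^ Suc n) ((fold bwd js ^^ Suc n) x) =
      (foldr fwd js ^^ n) (foldr fwd js (fold bwd js ((fold bwd js ^^ n) x)))"
    by (subst funpow_Suc_right) simp
  then show ?case by (simp add: foldr_fwd_fold_bwd Suc)
qed simp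

lemma finite_bounded_int_vec: "finite {x :: int ^ 3. norm (rvec x) \<le> c}"
proof -
  define A where "A = {- \<lceil>c\<rceil>..\<lceil>c\<rceil>}"
  have "{x :: int ^ 3. norm (rvec x) \<le> c} \<subseteq>
      (\<lambda>(a, b, d). \<chi> k. if k = 1 then a else if k = 2 then b else d) ` (A \<times> A \<times> A)"
  proof
    fix x :: "int ^ 3" assume "x \<in> {x. norm (rvec x) \<le> c}"
    then have le: "\<bar>real_of_int (x $ k)\<bar> \<le> c" for k
      using component_le_norm_cart [of "rvec x" k] by (simp add: rvec_def)
    have "x $ k \<in> A" for k
      using le [of k] unfolding A_def by (simp add: abs_le_iff) linarith
    moreover have "x = (\<chi> k. if k = 1 then x $ 1 else if k = 2 then x $ 2 else x $ 3)"
      by (simp add: vec_eq_iff forall_3)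
    ultimately show "x \<in> (\<lambda>(a, b, d). \<chi> k. if k = 1 then a else if k = 2 then b else d) ` (A \<times> A \<times> A)"
      by (intro image_eqI [of _ _ "(x $ 1, x $ 2, x $ 3)"]) auto
  qed
  then show ?thesis
    by (rule finite_subset) (simp add: A_def)
qed

text \<open>The images of the three letters have finitely many suffixes; this bounds the
  translations in one application of the dual substitution.\<close>

lemma suffix_vector_bound:
  obtains L where "\<And>j p i s. ar_product js [j] = p @ [i] @ s \<Longrightarrow> norm (rvec (abelianization s)) \<le> L"
proof -
  define S where "S = (\<Union>j. (\<lambda>n. drop n (ar_product js [j])) ` {..length (ar_product js [j])})"
  have "s \<in> S" if "ar_product js [j] = p @ [i] @ s" for j p i s
    unfolding S_def using that by (intro UN_I [of j] image_eqI [of _ _ "Suc (length p)"]) auto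
  moreover have "finite ((\<lambda>s. rvec (abelianization s)) ` S)"
    by (simp add: S_def)
  then obtain L where "\<forall>x \<in> (\<lambda>s. rvec (abelianization s)) ` S. norm x \<le> L"
    using finite_imp_bounded bounded_iff by metis
  ultimately show thesis using that by blast
qed

lemma fold_dual_step_nonempty: "F \<noteq> {} \<Longrightarrow> fold dual_step js F \<noteq> {}"
proof (induction js arbitrary: F)
  case (Cons i js)
  then obtain x k where "(x, k) \<in> F" by auto
  moreover have "dual_step i {(x, k)} \<noteq> {}"
    by (cases "k = i") (simp_all add: dual_step_same dual_step_other)
  ultimately have "dual_step i F \<noteq> {}"
    using dual_step_mono [of "{(x, k)}" F i] by blast
  then show ?case by (simp add: Cons.IH)
qed simp

lemma unit_face_bound:
  assumes "p \<in> unit_face f"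
  shows "norm (p - rvec (fst f)) \<le> 3"
proof -
  obtain x i where f: "f = (x, i)" by (cases f)
  have "\<bar>(p - rvec x) $ k\<bar> \<le> 1" for k
    using assms by (auto simp: f mem_unit_face rvec_def abs_le_iff dest!: spec [of _ k] split: if_splits)
  from this [of 1] this [of 2] this [of 3] show ?thesis
    using norm_le_l1_cart [of "p - rvec x"] by (simp add: f sum_3)
qed

section \<open>Patches, projected base points and convergence of the approximations\<close>

locale rauzy =
  fixes js :: "3 list" and u v :: "real ^ 3" and \<beta> :: real
  assumes js: "set js = UNIV" and u_pos: "\<And>k. 0 < u $ k" and v_pos: "\<And>k. 0 < v $ k"
    and u_eigen: "foldr fwd js u = \<beta> *\<^sub>R u" and v_eigen: "fold tfwd js v = \<beta> *\<^sub>R v"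
begin

abbreviation "M \<equiv> (foldr fwd js :: real ^ 3 \<Rightarrow> _)"
abbreviation "\<pi> \<equiv> contracting_proj u v"
abbreviation "E \<equiv> fold dual_step js"
abbreviation "patch n \<equiv> (E ^^ n) initial_faces"
abbreviation "D n \<equiv> (M ^^ n) ` \<pi> ` region (patch n)"
abbreviation "pt f \<equiv> \<pi> (rvec (fst f))"

lemma vu_pos: "0 < v \<bullet> u"
  using u_pos v_pos by (simp add: inner_vec3 add_pos_pos)

lemma linear_proj: "linear \<pi>"
  by (rule linearI) (simp_all add: contracting_proj_def algebra_simps inner_add_right add_divide_distrib)

lemma proj_orth: "v \<bullet> \<pi> x = 0"
  using vu_pos by (simp add: contracting_proj_def inner_diff_right)

lemma proj_id: "v \<bullet> x = 0 \<Longrightarrow> \<pi> x = x"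
  by (simp add: contracting_proj_def)

lemma v_inner_M: "v \<bullet> M x = \<beta> * (v \<bullet> x)"
  by (simp add: inner_foldr_fwd v_eigen)

lemma proj_M: "\<pi> (M x) = M (\<pi> x)"
  by (simp add: contracting_proj_def v_inner_M linear_diff [OF linear_foldr_fwd]
    linear_cmul [OF linear_foldr_fwd] u_eigen)

lemma v_inner_funpow_M: "v \<bullet> (M ^^ n) x = \<beta> ^ n * (v \<bullet> x)"
  by (induction n) (simp_all add: v_inner_M)

lemma \<beta>_pos: "0 < \<beta>"
  using fold_tfwd_pos [OF v_pos, of js 1] v_pos [of 1] by (simp add: v_eigen zero_less_mult_iff)

lemma orth_funpow_M: "v \<bullet> x = 0 \<Longrightarrow> v \<bullet> (M ^^ n) x = 0"
  by (simp add: v_inner_funpow_M)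

lemma linear_funpow_M: "linear (M ^^ n)"
  by (intro linear_funpow linear_foldr_fwd)

lemma D_connected: "connected (D n)"
proof -
  \<comment> \<open>Iterating \<open>E\<close> is folding over one longer word, as
    \<open>connected_region_initial\<close> requires.\<close>
  have "\<exists>w. \<forall>F. (E ^^ n) F = fold dual_step w F"
  proof (induction n)
    case 0
    then show ?case by (intro exI [of _ "[]"]) simp
  next
    case (Suc n)
    then obtain w where "\<forall>F. (E ^^ n) F = fold dual_step w F" by blast
    then show ?case by (intro exI [of _ "w @ js"]) simp
  qed
  then have "connected (region (patch n))"
    using connected_region_initial by metis
  then show ?thesis
    by (intro connected_continuous_image linear_continuous_on)
      (use linear_funpow_M linear_proj linear_conv_bounded_linear in blast)+
qed

lemma patch_nonempty: "patch n \<noteq> {}"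
proof (induction n)
  case 0
  then show ?case by (simp add: initial_faces_def)
next
  case (Suc n)
  then show ?case using fold_dual_step_nonempty by simp
qed

lemma pt_in_D: "f \<in> patch n \<Longrightarrow> (M ^^ n) (pt f) \<in> D n"
  by (intro imageI) (auto simp: region_def rvec_mem_unit_face intro!: bexI [of _ f] rvec_mem_unit_face [of "fst f" "snd f", simplified])

lemma D_nonempty: "D n \<noteq> {}"
  using patch_nonempty pt_in_D by blast

lemma D_orth: "x \<in> D n \<Longrightarrow> v \<bullet> x = 0"
  using orth_funpow_M proj_orth by blast

text \<open>After applying \<open>M\<close>, the projected base point of a face in
  \<open>E {f}\<close> differs from that of \<open>f\<close> by a projected suffix vector, of which
  there are finitely many; points of a face are near its base point.\<close>

lemma displacement:
  obtains C \<rho> L where "0 \<le> C" "0 \<le> \<rho>" "\<rho> < 1" "0 \<le> L"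
    "\<And>n x. v \<bullet> x = 0 \<Longrightarrow> norm ((M ^^ n) x) \<le> C * \<rho> ^ n * norm x"
    "\<And>f g. g \<in> E {f} \<Longrightarrow> norm (M (pt g) - pt f) \<le> L"
    "\<And>f p. p \<in> unit_face f \<Longrightarrow> norm (\<pi> p - pt f) \<le> L"
proof -
  obtain C \<rho> where C: "0 \<le> C" "0 \<le> \<rho>" "\<rho> < 1"
    "\<And>n x. v \<bullet> x = 0 \<Longrightarrow> norm ((M ^^ n) x) \<le> C * \<rho> ^ n * norm x"
    using foldr_fwd_contraction [OF js u_pos v_pos u_eigen v_eigen] by blast
  obtain B where B: "0 < B" "\<And>x. norm (\<pi> x) \<le> B * norm x"
    using linear_bounded_pos [OF linear_proj] by blast
  obtain L where L: "\<And>j p i s. ar_product js [j] = p @ [i] @ s \<Longrightarrow> norm (rvec (abelianization s)) \<le> L"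
    using suffix_vector_bound by blast
  have 1: "norm (M (pt g) - pt f) \<le> B * L" if g: "g \<in> E {f}" for f g
  proof -
    obtain x i y j where fg: "f = (x, i)" "g = (y, j)" by (cases f, cases g)
    have "g \<in> dual_face (ar_product js) f"
      using g dual_substitution_ar_product [of js "{f}"] by (simp add: dual_substitution_def)
    then obtain p s where s: "ar_product js [j] = p @ [i] @ s" "foldr fwd js y = x + abelianization s"
      unfolding fg mem_dual_face_ar_product by blast
    have "M (pt g) - pt f = \<pi> (rvec (abelianization s))"
      by (simp add: fg s rvec_simps linear_add [OF linear_proj] flip: proj_M rvec_foldr_fwd)
    also have "norm \<dots> \<le> B * norm (rvec (abelianization s))" by (rule B)
    also have "\<dots> \<le> B * L" using L [OF s(1)] B(1) by simp
    finally show ?thesis .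
  qed
  have 2: "norm (\<pi> p - pt f) \<le> B * 3" if "p \<in> unit_face f" for f p
  proof -
    have "norm (\<pi> p - pt f) \<le> B * norm (p - rvec (fst f))"
      using B(2) [of "p - rvec (fst f)"] by (simp add: linear_diff [OF linear_proj])
    also have "\<dots> \<le> B * 3" using unit_face_bound [OF that] B(1) by simp
    finally show ?thesis .
  qed
  show thesis
    by (rule that [OF C(1-3), of "max (B * L) (B * 3)"])
      (use C(4) B(1) 1 2 in \<open>auto simp: le_max_iff_disj\<close>)
qed

lemma E_member: "g \<in> E F \<Longrightarrow> \<exists>f\<in>F. g \<in> E {f}"
  using fold_dual_step_UN [of js "\<lambda>f. {f}" F] by auto

lemma limit:
  obtains R K \<rho> where "compact R" "R \<noteq> {}" "0 \<le> \<rho>" "\<rho> < 1"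
    "\<And>n a. a \<in> D n \<Longrightarrow> infdist a R \<le> K * \<rho> ^ n"
    "\<And>n r. r \<in> R \<Longrightarrow> infdist r (D n) \<le> K * \<rho> ^ n"
proof -
  obtain C \<rho> L where C: "0 \<le> C" "0 \<le> \<rho>" "\<rho> < 1" "0 \<le> L"
    "\<And>n x. v \<bullet> x = 0 \<Longrightarrow> norm ((M ^^ n) x) \<le> C * \<rho> ^ n * norm x"
    "\<And>f g. g \<in> E {f} \<Longrightarrow> norm (M (pt g) - pt f) \<le> L"
    "\<And>f p. p \<in> unit_face f \<Longrightarrow> norm (\<pi> p - pt f) \<le> L"
    using displacement by blast
  \<comment> \<open>\<open>2 * L + C * \<rho> * L\<close> bounds the distance of matching points in
    consecutive approximations before \<open>M ^^ n\<close> is applied: at most two moves of length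
    \<open>L\<close> and one move inside a face, shrunk by \<open>M\<close>.\<close>
  define K where "K = C * (2 * L + C * \<rho> * L)"
  have K: "0 \<le> K" using C by (simp add: K_def)
  have orth: "v \<bullet> (x - y) = 0" if "v \<bullet> x = 0" "v \<bullet> y = 0" for x y
    using that by (simp add: inner_diff_right)
  have est: "norm ((M ^^ n) x - (M ^^ n) y) \<le> K * \<rho> ^ n"
    if "v \<bullet> x = 0" "v \<bullet> y = 0" "norm (x - y) \<le> 2 * L + C * \<rho> * L" for x y n
  proof -
    have "norm ((M ^^ n) x - (M ^^ n) y) \<le> C * \<rho> ^ n * norm (x - y)"
      using C(5) [OF orth [OF that(1,2)], of n] by (simp add: linear_diff [OF linear_funpow_M])
    also have "\<dots> \<le> C * \<rho> ^ n * (2 * L + C * \<rho> * L)"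
      using that C by (intro mult_left_mono) auto
    finally show ?thesis by (simp add: K_def mult_ac)
  qed
  have nn: "0 \<le> C * \<rho> * L" using C by simp
  have v_M: "v \<bullet> M (\<pi> x) = 0" for x by (simp add: v_inner_M proj_orth)
  have D0: "bounded (D 0)"
  proof -
    have "norm x \<le> L + norm (\<pi> 0)" if x: "x \<in> D 0" for x
    proof -
      obtain f p where "f \<in> initial_faces" "p \<in> unit_face f" "x = \<pi> p"
        using x by (auto simp: region_def)
      moreover from this(1) have "pt f = \<pi> 0"
        by (auto simp: initial_faces_eq rvec_simps)
      ultimately show ?thesis
        using C(7) [of p f] norm_triangle_ineq2 [of "\<pi> p" "\<pi> 0"] by simp
    qed
    then show ?thesis by (auto simp: bounded_iff)
  qed
  have forward: "\<exists>b\<in>D (Suc n). dist a b \<le> K * \<rho> ^ n" if a: "a \<in> D n" for n a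
  proof -
    obtain f p where fp: "f \<in> patch n" "p \<in> unit_face f" "a = (M ^^ n) (\<pi> p)"
      using a by (auto simp: region_def)
    obtain g where g: "g \<in> E {f}" using fold_dual_step_nonempty [of "{f}"] by blast
    have "g \<in> patch (Suc n)"
      using g fold_dual_step_mono [of "{f}" "patch n" js] fp(1) by auto
    then have "(M ^^ n) (M (pt g)) \<in> D (Suc n)"
      using pt_in_D [of g "Suc n"] by (simp add: funpow_swap1)
    moreover have "norm (\<pi> p - M (pt g)) \<le> 2 * L + C * \<rho> * L"
      using C(6) [OF g] C(7) [OF fp(2)] norm_triangle_ineq4 [of "\<pi> p - pt f" "M (pt g) - pt f"] nn
      by simp
    then have "dist a ((M ^^ n) (M (pt g))) \<le> K * \<rho> ^ n"
      unfolding fp dist_norm by (intro est proj_orth v_M)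
    ultimately show ?thesis by blast
  qed
  have backward: "\<exists>a\<in>D n. dist a b \<le> K * \<rho> ^ n" if b: "b \<in> D (Suc n)" for n b
  proof -
    obtain g q where gq: "g \<in> patch (Suc n)" "q \<in> unit_face g" "b = (M ^^ n) (M (\<pi> q))"
      using b by (auto simp: region_def funpow_swap1)
    obtain f where f: "f \<in> patch n" "g \<in> E {f}"
      using E_member [of g "patch n"] gq(1) by auto
    have "norm ((M ^^ 1) (\<pi> q - pt g)) \<le> C * \<rho> ^ 1 * norm (\<pi> q - pt g)"
      by (intro C(5) orth proj_orth)
    then have "norm (M (\<pi> q - pt g)) \<le> C * \<rho> * norm (\<pi> q - pt g)"
      by simp
    also have "\<dots> \<le> C * \<rho> * L"
      using C(7) [OF gq(2)] C by (intro mult_left_mono) auto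
    finally have "norm (M (\<pi> q) - M (pt g)) \<le> C * \<rho> * L"
      by (simp add: linear_diff [OF linear_foldr_fwd])
    then have "norm (pt f - M (\<pi> q)) \<le> 2 * L + C * \<rho> * L"
      using C(6) [OF f(2)] C(4) norm_triangle_ineq [of "M (\<pi> q) - M (pt g)" "M (pt g) - pt f"]
      by (simp add: norm_minus_commute)
    then have "dist ((M ^^ n) (pt f)) b \<le> K * \<rho> ^ n"
      unfolding gq dist_norm by (intro est proj_orth v_M)
    then show ?thesis using pt_in_D [OF f(1)] by blast
  qed
  show thesis
  proof (rule geometric_hausdorff_limit [of "\<lambda>n. D n", OF D0 D_nonempty C(2,3) K forward backward])
    fix R
    assume R: "compact R" "R \<noteq> {}"
      "\<And>n a. a \<in> D n \<Longrightarrow> infdist a R \<le> K / (1 - \<rho>) * \<rho> ^ n"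
      "\<And>n r. r \<in> R \<Longrightarrow> infdist r (D n) \<le> K / (1 - \<rho>) * \<rho> ^ n"
    show thesis
      by (rule that [OF R(1,2) C(2,3) R(3,4)])
  qed
qed

section \<open>Covering a neighbourhood of the origin\<close>

lemma stepped_faces_dense:
  obtains K where "\<And>x. v \<bullet> x = 0 \<Longrightarrow> \<exists>f\<in>stepped_faces v. norm (pt f - x) \<le> K"
proof -
  obtain B where B: "0 < B" "\<And>x. norm (\<pi> x) \<le> B * norm x"
    using linear_bounded_pos [OF linear_proj] by blast
  define H where "H = v $ 1 + v $ 2 + v $ 3"
  have "\<exists>f\<in>stepped_faces v. norm (pt f - x) \<le> B * (3 + (H / v $ 1 + 1))" if x: "v \<bullet> x = 0" for x
  proof -
    \<comment> \<open>Rounding \<open>x\<close> down gives a height between \<open>- H\<close> and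
      0; adding \<open>c\<close> units along the first axis lifts it into the range allowed for
      faces of type 1.\<close>
    define y :: "int ^ 3" where "y = (\<chi> k. \<lfloor>x $ k\<rfloor>)"
    define h where "h = v \<bullet> rvec y"
    define c where "c = \<lceil>- h / v $ 1\<rceil>"
    define f where "f = (y + c *s axis 1 1, 1::3)"
    have frac: "0 \<le> (x - rvec y) $ k" "(x - rvec y) $ k \<le> 1" for k
      by (simp_all add: y_def rvec_def) linarith
    have hfrac: "- h = v \<bullet> (x - rvec y)" by (simp add: h_def inner_diff_right x)
    have "v $ k * (x - rvec y) $ k \<le> v $ k * 1" "0 \<le> v $ k * (x - rvec y) $ k" for k
      using frac [of k] v_pos [of k] by (intro mult_left_mono mult_nonneg_nonneg; simp)+
    from this [of 1] this [of 2] this [of 3] have h: "0 \<le> - h" "- h \<le> H"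
      unfolding hfrac by (simp_all add: H_def inner_vec3)
    have c: "- h / v $ 1 \<le> c" "c < - h / v $ 1 + 1"
      unfolding c_def by linarith+
    have v1: "0 < v $ 1" by (rule v_pos)
    have hc: "- h \<le> c * v $ 1" "c * v $ 1 < - h + v $ 1"
      using c v1 by (simp_all add: field_simps)
    have "f \<in> stepped_faces v"
      using hc by (simp add: f_def stepped_faces_def rvec_simps inner_add_right inner_axis h_def [symmetric])
    have "0 \<le> real_of_int c"
      using c(1) h(1) v1 by (metis divide_nonneg_pos order_trans)
    moreover have "real_of_int c \<le> H / v $ 1 + 1"
      using c(2) divide_right_mono [OF h(2), of "v $ 1"] v1 by linarith
    moreover have "norm (rvec y - x) \<le> 3"
      using norm_le_l1_cart [of "x - rvec y"] frac [of 1] frac [of 2] frac [of 3]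
      by (simp add: sum_3 norm_minus_commute)
    ultimately have "norm (rvec (fst f) - x) \<le> 3 + (H / v $ 1 + 1)"
      using norm_triangle_ineq [of "rvec y - x" "real_of_int c *\<^sub>R axis 1 1"]
      by (simp add: f_def rvec_simps algebra_simps)
    then have "norm (\<pi> (rvec (fst f) - x)) \<le> B * (3 + (H / v $ 1 + 1))"
      using order_trans [OF B(2) mult_left_mono [OF _ less_imp_le [OF B(1)]]] by blast
    then have "norm (pt f - x) \<le> B * (3 + (H / v $ 1 + 1))"
      by (simp add: linear_diff [OF linear_proj] proj_id [OF x])
    with \<open>f \<in> stepped_faces v\<close> show ?thesis by blast
  qed
  then show thesis using that by blast
qed

text \<open>Heights on the surface are bounded, and height and projection together bound the
  integral base point.\<close>

lemma finite_stepped_faces_near: "finite {f \<in> stepped_faces v. norm (pt f) \<le> K}"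
proof -
  define Q where "Q = K + (v $ 1 + v $ 2 + v $ 3) / (v \<bullet> u) * norm u"
  have "norm (rvec (fst f)) \<le> Q" if f: "f \<in> stepped_faces v" "norm (pt f) \<le> K" for f
  proof -
    let ?h = "v \<bullet> rvec (fst f)"
    have "v $ k \<le> v $ 1 + v $ 2 + v $ 3" for k
      using v_pos [of 1] v_pos [of 2] v_pos [of 3] by (cases k rule: cases_3; hypsubst; linarith)
    from this [of "snd f"] have h: "0 \<le> ?h" "?h \<le> v $ 1 + v $ 2 + v $ 3"
      using f(1) by (auto simp: stepped_faces_def)
    have "norm (rvec (fst f)) = norm (pt f + (?h / (v \<bullet> u)) *\<^sub>R u)"
      by (simp add: contracting_proj_def)
    also have "\<dots> \<le> norm (pt f) + norm ((?h / (v \<bullet> u)) *\<^sub>R u)"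
      by (rule norm_triangle_ineq)
    also have "norm ((?h / (v \<bullet> u)) *\<^sub>R u) \<le> (v $ 1 + v $ 2 + v $ 3) / (v \<bullet> u) * norm u"
      using h vu_pos by (simp add: mult_right_mono divide_right_mono)
    finally show ?thesis using f(2) by (simp add: Q_def)
  qed
  then have "{f \<in> stepped_faces v. norm (pt f) \<le> K} \<subseteq> {x. norm (rvec x) \<le> Q} \<times> UNIV"
    by fastforce
  then show ?thesis
    by (rule finite_subset) (intro finite_cartesian_product finite_bounded_int_vec finite)
qed

lemma finite_stepped_faces_generated:
  assumes "finite F" "F \<subseteq> stepped_faces v"
  shows "\<exists>n. F \<subseteq> patch n"
  using assms
proof (induction F rule: finite_induct)
  case (insert f F)
  then obtain n where n: "F \<subseteq> patch n" by auto
  obtain m where "f \<in> patch m"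
    using stepped_faces_generated [OF js v_pos v_eigen] insert.prems by blast
  with n show ?case
    using funpow_initial_mono [of n "max m n" js] funpow_initial_mono [of m "max m n" js]
    by (intro exI [of _ "max m n"]) auto
qed simp

text \<open>Pull \<open>x\<close> back by \<open>M ^^ n\<close>, take a stepped face
  \<open>g\<close> near it and an \<open>n\<close>-fold preimage \<open>f\<close> of
  \<open>g\<close>. Uniformly in \<open>n\<close>, \<open>f\<close> is one of finitely many faces,
  all contained in a single \<open>patch N\<close>; hence \<open>g\<close> is in
  \<open>patch (n + N)\<close>.\<close>

lemma ball_covered:
  obtains N c \<rho> where "0 \<le> \<rho>" "\<rho> < 1"
    "\<And>n x. v \<bullet> x = 0 \<Longrightarrow> norm x < 1 \<Longrightarrow> infdist ((M ^^ N) x) (D (n + N)) \<le> c * \<rho> ^ n"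
proof -
  obtain C \<rho> L where C: "0 \<le> C" "0 \<le> \<rho>" "\<rho> < 1" "0 \<le> L"
    "\<And>n x. v \<bullet> x = 0 \<Longrightarrow> norm ((M ^^ n) x) \<le> C * \<rho> ^ n * norm x"
    "\<And>f g. g \<in> E {f} \<Longrightarrow> norm (M (pt g) - pt f) \<le> L"
    "\<And>f p. p \<in> unit_face f \<Longrightarrow> norm (\<pi> p - pt f) \<le> L"
    using displacement by blast
  obtain K where K: "\<And>x. v \<bullet> x = 0 \<Longrightarrow> \<exists>f\<in>stepped_faces v. norm (pt f - x) \<le> K"
    using stepped_faces_dense by blast
  have "0 \<le> K"
  proof -
    obtain f where "norm (pt f - 0) \<le> K" using K [of 0] by auto
    then show ?thesis using norm_ge_zero order_trans by blast
  qed
  have orth: "v \<bullet> (x - y) = 0" if "v \<bullet> x = 0" "v \<bullet> y = 0" for x y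
    using that by (simp add: inner_diff_right)
  \<comment> \<open>Each further generation moves the rescaled base point by a geometrically smaller
    amount, so the total drift is bounded independently of \<open>n\<close>.\<close>
  have drift: "norm ((M ^^ n) (pt g) - pt f) \<le> C * L / (1 - \<rho>) * (1 - \<rho> ^ n)" if "g \<in> (E ^^ n) {f}" for n f g
    using that
  proof (induction n arbitrary: g)
    case (Suc n)
    then have "g \<in> E ((E ^^ n) {f})" by simp
    from E_member [OF this] obtain h where h: "h \<in> (E ^^ n) {f}" "g \<in> E {h}" by blast
    have "norm ((M ^^ n) (M (pt g) - pt h)) \<le> C * \<rho> ^ n * norm (M (pt g) - pt h)"
      by (intro C(5) orth) (simp_all add: v_inner_M proj_orth)
    also have "\<dots> \<le> C * \<rho> ^ n * L"
      using C(6) [OF h(2)] C by (intro mult_left_mono) auto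
    finally have "norm ((M ^^ Suc n) (pt g) - (M ^^ n) (pt h)) \<le> C * \<rho> ^ n * L"
      by (simp add: linear_diff [OF linear_funpow_M] funpow_swap1)
    then have "norm ((M ^^ Suc n) (pt g) - pt f) \<le> C * \<rho> ^ n * L + C * L / (1 - \<rho>) * (1 - \<rho> ^ n)"
      using Suc.IH [OF h(1)]
        norm_triangle_ineq [of "(M ^^ Suc n) (pt g) - (M ^^ n) (pt h)" "(M ^^ n) (pt h) - pt f"]
      by simp
    also have "\<dots> = C * L / (1 - \<rho>) * (1 - \<rho> ^ Suc n)"
      using C(3) by (simp add: field_simps)
    finally show ?case .
  qed simp
  \<comment> \<open>The norm of \<open>x\<close>, the distance from \<open>x\<close> to
    \<open>(M ^^ n) (pt g)\<close> and the drift. No term depends on \<open>n\<close> or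
    \<open>x\<close>, hence neither does \<open>N\<close>.\<close>
  define Q where "Q = 1 + C * K + C * L / (1 - \<rho>)"
  obtain N where N: "{f \<in> stepped_faces v. norm (pt f) \<le> Q} \<subseteq> patch N"
    using finite_stepped_faces_generated [OF finite_stepped_faces_near] by blast
  have "infdist ((M ^^ N) x) (D (n + N)) \<le> C * \<rho> ^ N * (C * K) * \<rho> ^ n"
    if x: "v \<bullet> x = 0" "norm x < 1" for n x
  proof -
    define y where "y = (fold bwd js ^^ n) x"
    have My: "(M ^^ n) y = x" by (simp add: y_def funpow_fwd_bwd)
    have y: "v \<bullet> y = 0"
      using v_inner_funpow_M [of n y] \<beta>_pos by (simp add: My x)
    obtain g where g: "g \<in> stepped_faces v" "norm (pt g - y) \<le> K" using K [OF y] by blast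
    obtain f where f: "f \<in> stepped_faces v" "g \<in> (E ^^ n) {f}"
      using stepped_faces_preimage [OF js v_pos v_eigen g(1)] by blast
    have "norm ((M ^^ n) (pt g - y)) \<le> C * \<rho> ^ n * norm (pt g - y)"
      by (intro C(5) orth proj_orth y)
    also have "\<dots> \<le> C * \<rho> ^ n * K"
      using g(2) C by (intro mult_left_mono) auto
    finally have gx: "norm ((M ^^ n) (pt g) - x) \<le> C * K * \<rho> ^ n"
      by (simp add: linear_diff [OF linear_funpow_M] My mult_ac)
    have "norm (pt f) \<le> Q"
    proof -
      have "C * K * \<rho> ^ n \<le> C * K * 1"
        using C \<open>0 \<le> K\<close> by (intro mult_left_mono power_le_one) auto
      moreover have "C * L / (1 - \<rho>) * (1 - \<rho> ^ n) \<le> C * L / (1 - \<rho>) * 1"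
        using C by (intro mult_left_mono) auto
      ultimately show ?thesis
        using drift [OF f(2)] gx x(2) norm_triangle_ineq4 [of "(M ^^ n) (pt g)" "(M ^^ n) (pt g) - pt f"]
          norm_triangle_sub [of "(M ^^ n) (pt g)" x] unfolding Q_def by simp
    qed
    with N f(1) have "{f} \<subseteq> patch N" by blast
    from funpow_fold_dual_step_mono [OF this, of n js] f(2) have "g \<in> patch (n + N)"
      by (auto simp: funpow_add)
    then have "infdist ((M ^^ N) x) (D (n + N)) \<le> dist ((M ^^ N) x) ((M ^^ (n + N)) (pt g))"
      by (intro infdist_le pt_in_D)
    also have "\<dots> = norm ((M ^^ N) ((M ^^ n) (pt g) - x))"
      by (simp add: dist_norm norm_minus_commute add.commute [of n N] funpow_add
        linear_diff [OF linear_funpow_M])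
    also have "\<dots> \<le> C * \<rho> ^ N * norm ((M ^^ n) (pt g) - x)"
      by (intro C(5) orth orth_funpow_M proj_orth x)
    also have "\<dots> \<le> C * \<rho> ^ N * (C * K * \<rho> ^ n)"
      using gx C by (intro mult_left_mono) auto
    finally show ?thesis by (simp add: mult_ac)
  qed
  then show thesis using that C(2,3) by blast
qed

section \<open>Identification of the limit with the Rauzy fractal\<close>

lemma incidence_matrix_mult: "(*v) (incidence_matrix (ar_product js)) = M"
  by (rule ext) (rule incidence_matrix_ar_product)

lemma rauzy_approx_eq: "rauzy_approx (ar_product js) u v = (\<lambda>n. D n)"
proof -
  have "dual_substitution (ar_product js) = E"
    by (rule ext) (rule dual_substitution_ar_product)
  then show ?thesis
    by (intro ext) (simp add: rauzy_approx_def incidence_matrix_mult)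
qed

lemma rauzy_fractal_properties:
  "connected (rauzy_fractal (ar_product js) u v) \<and>
    0 \<in> (top_of_set (contracting_plane v)) interior_of (rauzy_fractal (ar_product js) u v)"
proof -
  obtain R K \<rho> where R: "compact R" "R \<noteq> {}" and \<rho>: "0 \<le> \<rho>" "\<rho> < 1"
    and DR: "\<And>n a. a \<in> D n \<Longrightarrow> infdist a R \<le> K * \<rho> ^ n"
    and RD: "\<And>n r. r \<in> R \<Longrightarrow> infdist r (D n) \<le> K * \<rho> ^ n"
    by (rule limit) (rule that)
  have geometric: "(\<lambda>n. c * r ^ n) \<longlonglongrightarrow> 0" if "0 \<le> r" "r < 1" for c r :: real
    using that tendsto_mult_left [OF LIMSEQ_realpow_zero, of r c] by simp
  have bounded_D: "bounded (D n)" for n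
  proof -
    obtain e where e: "\<And>r. r \<in> R \<Longrightarrow> norm r \<le> e"
      using compact_imp_bounded [OF R(1)] bounded_iff by blast
    have "norm a \<le> e + (K * \<rho> ^ n + 1)" if a: "a \<in> D n" for a
    proof -
      have "infdist a R < K * \<rho> ^ n + 1" using DR [OF a] by linarith
      then obtain r where r: "r \<in> R" "dist a r < K * \<rho> ^ n + 1" using infdist_lessE R(2) by blast
      then show ?thesis
        using e [OF r(1)] norm_triangle_sub [of a r] by (simp add: dist_norm)
    qed
    then show ?thesis by (auto simp: bounded_iff)
  qed
  have lim: "(\<lambda>n. hausdorff_distance (D n) R) \<longlonglongrightarrow> 0"
  proof (rule tendsto_sandwich [OF _ _ tendsto_const geometric [OF \<rho>, of K]])
    show "\<forall>\<^sub>F n in sequentially. 0 \<le> hausdorff_distance (D n) R"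
      by (intro always_eventually allI hausdorff_distance_nonneg bounded_D D_nonempty R compact_imp_bounded)
    show "\<forall>\<^sub>F n in sequentially. hausdorff_distance (D n) R \<le> K * \<rho> ^ n"
      by (intro always_eventually allI hausdorff_distance_le D_nonempty R DR RD)
  qed
  have "R \<subseteq> contracting_plane v"
  proof
    fix r assume r: "r \<in> R"
    have D_sub: "D n \<subseteq> contracting_plane v" for n
      using D_orth by (auto simp: contracting_plane_def)
    have "infdist r (contracting_plane v) \<le> 0"
    proof (rule LIMSEQ_le_const [OF geometric [OF \<rho>, of K]])
      show "\<exists>N. \<forall>n\<ge>N. infdist r (contracting_plane v) \<le> K * \<rho> ^ n"
        using order_trans [OF infdist_mono [OF D_sub D_nonempty] RD [OF r]] by blast
    qed
    then have "infdist r (contracting_plane v) = 0"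
      using infdist_nonneg [of r "contracting_plane v"] by linarith
    moreover have "closed (contracting_plane v)" "contracting_plane v \<noteq> {}"
      using closed_hyperplane [of v 0] by (auto simp: contracting_plane_def intro: exI [of _ 0])
    ultimately show "r \<in> contracting_plane v"
      using in_closed_iff_infdist_zero by blast
  qed
  then have fractal: "rauzy_fractal (ar_product js) u v = R"
    unfolding rauzy_fractal_def rauzy_approx_eq
    using R lim hausdorff_limit_unique [of "\<lambda>n. D n", OF bounded_D D_nonempty]
    by (intro the_equality) blast+
  have "connected R"
    by (rule connected_hausdorff_limit [of "\<lambda>n. D n", OF bounded_D D_nonempty D_connected R lim])
  moreover have "0 \<in> (top_of_set (contracting_plane v)) interior_of R"
  proof -
    obtain N c \<tau> where \<tau>: "0 \<le> \<tau>" "\<tau> < 1"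
      and cover: "\<And>n x. v \<bullet> x = 0 \<Longrightarrow> norm x < 1 \<Longrightarrow> infdist ((M ^^ N) x) (D (n + N)) \<le> c * \<tau> ^ n"
      by (rule ball_covered) (rule that)
    have in_R: "(M ^^ N) x \<in> R" if x: "v \<bullet> x = 0" "norm x < 1" for x
    proof -
      \<comment> \<open>Pass through a point of \<open>D (n + N)\<close>: the covering and the
        convergence to \<open>R\<close> each contribute an error that vanishes with
        \<open>n\<close>.\<close>
      have le: "infdist ((M ^^ N) x) R \<le> c * \<tau> ^ n + K * \<rho> ^ N * \<rho> ^ n" for n
      proof (rule field_le_epsilon)
        fix e :: real assume "0 < e"
        then have "infdist ((M ^^ N) x) (D (n + N)) < c * \<tau> ^ n + e"
          using cover [OF x, of n] by linarith
        then obtain d where "d \<in> D (n + N)" "dist ((M ^^ N) x) d < c * \<tau> ^ n + e"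
          by (rule infdist_lessE [OF _ D_nonempty])
        then show "infdist ((M ^^ N) x) R \<le> c * \<tau> ^ n + K * \<rho> ^ N * \<rho> ^ n + e"
          using DR [of d "n + N"] infdist_triangle [of "(M ^^ N) x" R d] by (simp add: power_add mult_ac)
      qed
      have "(\<lambda>n. c * \<tau> ^ n + K * \<rho> ^ N * \<rho> ^ n) \<longlonglongrightarrow> 0"
        using tendsto_add [OF geometric [OF \<tau>, of c] geometric [OF \<rho>, of "K * \<rho> ^ N"]] by simp
      then have "infdist ((M ^^ N) x) R \<le> 0"
        by (rule LIMSEQ_le_const) (use le in blast)
      then have "infdist ((M ^^ N) x) R = 0"
        using infdist_nonneg [of "(M ^^ N) x" R] by linarith
      then show ?thesis
        using in_closed_iff_infdist_zero [OF compact_imp_closed [OF R(1)] R(2)] by blast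
    qed
    let ?B = "fold bwd js ^^ N :: real ^ 3 \<Rightarrow> _"
    \<comment> \<open>The image under \<open>M ^^ N\<close> of the open unit disc of the plane,
      written as a preimage under the inverse \<open>?B\<close> so that it is visibly relatively
      open.\<close>
    define T where "T = contracting_plane v \<inter> ?B -` ball 0 1"
    have "linear ?B" by (intro linear_funpow linear_fold_bwd)
    then have "continuous_on UNIV ?B"
      by (intro linear_continuous_on) (simp add: linear_conv_bounded_linear)
    then have "open (?B -` ball 0 1)"
      by (intro open_vimage) auto
    then have "openin (top_of_set (contracting_plane v)) T"
      unfolding T_def by (rule openin_open_Int)
    moreover have "0 \<in> T"
      using linear_0 [OF \<open>linear ?B\<close>] by (simp add: T_def contracting_plane_def)
    moreover have "T \<subseteq> R"
    proof
      fix x assume x: "x \<in> T"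
      have "v \<bullet> (M ^^ N) (?B x) = \<beta> ^ N * (v \<bullet> ?B x)"
        by (rule v_inner_funpow_M)
      then have "v \<bullet> ?B x = 0"
        using x \<beta>_pos by (simp add: funpow_fwd_bwd T_def contracting_plane_def)
      then show "x \<in> R"
        using in_R [of "?B x"] x by (simp add: funpow_fwd_bwd T_def)
    qed
    ultimately show ?thesis
      unfolding interior_of_def by blast
  qed
  ultimately show ?thesis by (simp add: fractal)
qed

end

text \<open>The transpose is the adjoint for the inner product, and \<open>inner_foldr_fwd\<close>
  computes the adjoint of \<open>foldr fwd js\<close>.\<close>

lemma transpose_incidence_matrix_ar_product:
  "transpose (incidence_matrix (ar_product js)) *v x = fold tfwd js (x :: real ^ 3)"
proof (rule vector_eq_ldot [THEN iffD1], intro allI)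
  fix y :: "real ^ 3"
  show "y \<bullet> (transpose (incidence_matrix (ar_product js)) *v x) = y \<bullet> fold tfwd js x"
    unfolding inner_commute [of y] transpose_matrix_vector dot_lmul_matrix incidence_matrix_ar_product
    by (rule inner_foldr_fwd)
qed

theorem theorem4p6:
  fixes js :: "3 list" and \<sigma> :: "3 list \<Rightarrow> 3 list" and \<beta> :: real and u v :: "real ^ 3"
  assumes "\<sigma> = foldr (\<circ>) (map arnoux_rauzy js) id"
    and "set js = {1, 2, 3}"
    and "maximal_eigenvalue \<sigma> \<beta>"
    and "incidence_matrix \<sigma> *v u = \<beta> *\<^sub>R u" and "\<And>i. u $ i > 0"
    and "transpose (incidence_matrix \<sigma>) *v v = \<beta> *\<^sub>R v" and "\<And>i. v $ i > 0"
  shows "connected (rauzy_fractal \<sigma> u v) \<and>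
    0 \<in> (top_of_set (contracting_plane v)) interior_of (rauzy_fractal \<sigma> u v)"
proof -
  have \<sigma>: "\<sigma> = ar_product js"
    by (simp only: assms(1) ar_product_def)
  interpret rauzy js u v \<beta>
  proof
    show "set js = UNIV" by (simp only: assms(2) UNIV_3)
    show "foldr fwd js u = \<beta> *\<^sub>R u"
      using assms(4) by (simp only: \<sigma> incidence_matrix_ar_product)
    show "fold tfwd js v = \<beta> *\<^sub>R v"
      using assms(6) by (simp only: \<sigma> transpose_incidence_matrix_ar_product)
  qed (fact assms)+
  show ?thesis
    unfolding \<sigma> by (rule rauzy_fractal_properties)
qed

end
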